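(* Let $(W_n)_{n=1}^\infty$ be any $\mathcal P$-$e$-process and let $Q$ be an alternative distribution. Then, with $Q$-probability one, $$\limsup_{n\to\infty}\frac1n\log(W_n)\le \ell_Q^\star,\qquad\text{where}\quad \ell_Q^\star=\max_{\lambda\in\triangle_d}\mathbb E_Q\left[\log(\lambda^\top\mathbf E_1)\right].$$
   Context: Fix $d\in\mathbb N$ and let $\triangle_d=\{\lambda\in[0,1]^{d+1}:\sum_{j=0}^d\lambda^{(j)}=1\}$. Let $(\mathbf E_n)_{n=1}^\infty$, $\mathbf E_n=(E_n^{(0)},\dots,E_n^{(d)})$, be random vectors with values in $[0,\infty)^{d+1}$ such that $E_n^{(0)}=1$ deterministically; the coordinates of $\mathbf E_n$ may be arbitrarily dependent. Let $\mathcal F_n=\sigma(\mathbf E_1,\dots,\mathbf E_n)$, with $\mathcal F_0$ trivial. Under every distribution considered, $(\mathbf E_n)$ is i.i.d. Null hypothesis: $\mathcal P$ is the set of all distributions $P$ (making $(\mathbf E_n)$ i.i.d.) with $\mathbb E_P[E_1^{(j)}]\le 1$ for each $j\in\{1,\dots,d\}$. An alternative distribution is a distribution $Q$ under which $(\mathbf E_n)$ is i.i.d. A test $P$-supermartingale is a nonnegative adapted process $(M_n)$ with $\mathbb E_P[M_n\mid\mathcal F_{n-1}]\le M_{n-1}$ $P$-a.s. for $n\ge2$ and $\mathbb E_P[M_1]\le1$. A $\mathcal P$-$e$-process is a nonnegative adapted process $(W_n)$ such that for each $P\in\mathcal P$ there is a test $P$-supermartingale $(M_n^{(P)})$ with $W_n\le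 M_n^{(P)}$ for all $n$, $P$-a.s. Conventions: $\log 0=-\infty$; $\ell_Q^\star$ may equal $+\infty$; the expectations defining $\ell_Q^\star$ are understood to be well defined. *)

theory Defs
  imports "HOL-Probability.Probability"
begin

text \<open>
  The coordinates $0, 1, \dots, d$ are indexed by \<^typ>\<open>'d option\<close>: \<^term>\<open>None\<close> is coordinate $0$,
  and the \<^term>\<open>Some j\<close> are the coordinates $1, \dots, d$, where $d$ is the cardinality of the
  finite type \<^typ>\<open>'d\<close>.
\<close>

definition obs_space :: "(real ^ 'd::finite option) measure" where
  "obs_space = restrict_space borel {e. (\<forall>j. 0 \<le> e $ j) \<and> e $ None = 1}"

text \<open>
  A distribution is a law of the whole sequence $(\mathbf E_n)_{n \ge 1}$, that is, a probability
  measure on the sequence space, on which $\mathbf E_n$ is the $n$-th coordinate. Adapted processes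
  and almost sure events only depend on the sequence. A fixed underlying sample space on which not
  every law is realised would make the class of null distributions too small (possibly empty).
\<close>

definition seq_space :: "(nat \<Rightarrow> real ^ 'd::finite option) measure" where
  "seq_space = (\<Pi>\<^sub>M n\<in>{1..}. obs_space)"

definition E :: "nat \<Rightarrow> (nat \<Rightarrow> real ^ 'd::finite option) \<Rightarrow> real ^ 'd option" where
  "E n \<omega> = \<omega> n"

definition Filt :: "nat \<Rightarrow> (nat \<Rightarrow> real ^ 'd::finite option) measure" where
  "Filt n = sigma (space seq_space)
     {E i -` A \<inter> space seq_space | i A. i \<in> {1..n} \<and> A \<in> sets obs_space}"

definition iid_distribution :: "(nat \<Rightarrow> real ^ 'd::finite option) measure \<Rightarrow> bool" where
  "iid_distribution P \<longleftrightarrow>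
     prob_space P \<and> sets P = sets seq_space \<and>
     prob_space.indep_vars P (\<lambda>_. obs_space) E {1..} \<and>
     (\<forall>n\<ge>1. distr P obs_space (E n) = distr P obs_space (E 1))"

definition null_hypothesis :: "(nat \<Rightarrow> real ^ 'd::finite option) measure set" where
  "null_hypothesis =
     {P. iid_distribution P \<and> (\<forall>j. (\<integral>\<^sup>+ \<omega>. ennreal (E 1 \<omega> $ Some j) \<partial>P) \<le> 1)}"

text \<open>Processes are indexed by $n \ge 1$; their value at $0$ is irrelevant.\<close>

definition nonneg_adapted ::
    "(nat \<Rightarrow> (nat \<Rightarrow> real ^ 'd::finite option) \<Rightarrow> real) \<Rightarrow> bool" where
  "nonneg_adapted X \<longleftrightarrow>
     (\<forall>n\<ge>1. X n \<in> borel_measurable (Filt n) \<and> (\<forall>\<omega>\<in>space seq_space. 0 \<le> X n \<omega>))"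

text \<open>
  Expectations of nonnegative variables are taken in $[0,\infty]$, so that integrability is a
  consequence of the bounds; \<^const>\<open>nn_cond_exp\<close> is the corresponding conditional expectation.
\<close>

definition test_supermartingale ::
    "(nat \<Rightarrow> real ^ 'd::finite option) measure \<Rightarrow>
     (nat \<Rightarrow> (nat \<Rightarrow> real ^ 'd option) \<Rightarrow> real) \<Rightarrow> bool" where
  "test_supermartingale P M \<longleftrightarrow>
     nonneg_adapted M \<and>
     (\<forall>n\<ge>2. AE \<omega> in P.
        nn_cond_exp P (Filt (n - 1)) (\<lambda>\<omega>. ennreal (M n \<omega>)) \<omega> \<le> ennreal (M (n - 1) \<omega>)) \<and>
     (\<integral>\<^sup>+ \<omega>. ennreal (M 1 \<omega>) \<partial>P) \<le> 1"

definition e_process ::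
    "(nat \<Rightarrow> real ^ 'd::finite option) measure set \<Rightarrow>
     (nat \<Rightarrow> (nat \<Rightarrow> real ^ 'd option) \<Rightarrow> real) \<Rightarrow> bool" where
  "e_process \<P> W \<longleftrightarrow>
     nonneg_adapted W \<and>
     (\<forall>P\<in>\<P>. \<exists>M. test_supermartingale P M \<and> (AE \<omega> in P. \<forall>n\<ge>1. W n \<omega> \<le> M n \<omega>))"

definition prob_simplex :: "(real ^ 'd::finite option) set" where
  "prob_simplex = {l. (\<forall>j. 0 \<le> l $ j \<and> l $ j \<le> 1) \<and> (\<Sum>j\<in>UNIV. l $ j) = 1}"

text \<open>The logarithm on $[0,\infty)$ with the convention $\log 0 = -\infty$.\<close>

definition elog :: "real \<Rightarrow> ereal" where
  "elog x = (if x = 0 then - \<infinity> else ereal (ln x))"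

text \<open>
  The expectation of an extended real variable is the difference of the expectations of its
  positive and negative parts, which \<^const>\<open>e2ennreal\<close> (it maps negative values to $0$)
  extracts. It is well defined if these are not both infinite.
\<close>

definition ereal_expectation :: "'a measure \<Rightarrow> ('a \<Rightarrow> ereal) \<Rightarrow> ereal" where
  "ereal_expectation M f =
     enn2ereal (\<integral>\<^sup>+ x. e2ennreal (f x) \<partial>M) - enn2ereal (\<integral>\<^sup>+ x. e2ennreal (- f x) \<partial>M)"

definition ereal_expectation_defined :: "'a measure \<Rightarrow> ('a \<Rightarrow> ereal) \<Rightarrow> bool" where
  "ereal_expectation_defined M f \<longleftrightarrow>
     (\<integral>\<^sup>+ x. e2ennreal (f x) \<partial>M) < \<infinity> \<or> (\<integral>\<^sup>+ x. e2ennreal (- f x) \<partial>M) < \<infinity>"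

definition growth_rate ::
    "(nat \<Rightarrow> real ^ 'd::finite option) measure \<Rightarrow> real ^ 'd option \<Rightarrow> ereal" where
  "growth_rate Q l = ereal_expectation Q (\<lambda>\<omega>. elog (l \<bullet> E 1 \<omega>))"

text \<open>
  That the supremum is attained, i.e. is a maximum, is part of the claim using this constant.
\<close>

definition ell_star :: "(nat \<Rightarrow> real ^ 'd::finite option) measure \<Rightarrow> ereal" where
  "ell_star Q = (SUP l\<in>prob_simplex. growth_rate Q l)"

end

theory Submission
  imports Defs
begin

text \<open>
  Write \<open>\<mu>\<close> for the law under \<open>Q\<close> of one observation \<open>V\<close>. The idea is to find a null distribution \<open>P\<close> such that
  the likelihood ratio of \<open>Q\<close> against \<open>P\<close> has exponential growth rate at most \<open>ell_star Q\<close> under \<open>Q\<close>; as an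
  e-process has expectation at most \<open>1\<close> under \<open>P\<close>, it cannot grow at a faster rate than that ratio.
  
  The maximum is attained because the deficit of the growth rate below \<open>\<integral> ln (\<Sum>j. V j) \<partial>\<mu>\<close> is an integral
  of a nonnegative function, hence lower semicontinuous by Fatou's lemma on the compact simplex; if
  \<open>\<integral> ln (\<Sum>j. V j) \<partial>\<mu>\<close> is itself infinite, the uniform weights already have an infinite growth rate
  (\<open>growth_attains_max\<close>). If the maximal rate is infinite, the bound is trivial.
  
  Otherwise let \<open>l\<close> be a maximiser. Moving from \<open>l\<close> towards any vertex \<open>j\<close> cannot increase the growth rate,
  and the directional derivative of that move shows \<open>\<integral> V j / (l \<bullet> V) \<partial>\<mu> \<le> 1\<close>
  (\<open>growth_maximiser_numeraire\<close>). Consequently the measure with density \<open>1 / (l \<bullet> e)\<close> with respect to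
  \<open>\<mu>\<close> gives each coordinate expectation at most \<open>1\<close>, and coordinate \<open>0\<close>, which is constantly \<open>1\<close>, shows
  that its mass is at most \<open>1\<close>. Placing the missing mass at the point whose other coordinates vanish
  preserves these bounds, so the infinite product \<open>P\<close> of the resulting probability measure lies in the
  null hypothesis. The expectation of \<open>W n * (\<Prod>i\<le>n. 1 / (l \<bullet> E i))\<close> under \<open>Q\<close> is at most the expectation
  of \<open>W n\<close> under \<open>P\<close> (\<open>nn_integral_seq_space_density_le\<close>), hence at most \<open>1\<close>. By Markov's inequality and the
  Borel--Cantelli lemma this variable is eventually below \<open>exp (\<epsilon> * n)\<close>, and by the upper half of the
  strong law of large numbers (\<open>iid_sum_eventually_le\<close>) the logarithm of the product of the \<open>l \<bullet> E i\<close> is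
  eventually below \<open>n * (ell_star Q + \<epsilon>)\<close>.
\<close>

section \<open>Random walks with negative drift\<close>

text \<open>
  The maximum of the first \<open>n\<close> partial sums and \<open>0\<close>, by recursion on the first increment: this form
  relates the maximum of a sequence to that of its shift.
\<close>

primrec walk_max :: "nat \<Rightarrow> (nat \<Rightarrow> real) \<Rightarrow> real" where
  "walk_max 0 x = 0"
| "walk_max (Suc n) x = max 0 (x 0 + walk_max n (\<lambda>k. x (Suc k)))"

lemma walk_max_nonneg: "0 \<le> walk_max n x"
  by (cases n) auto

lemma sum_le_walk_max: "(\<Sum>i<n. x i) \<le> walk_max n x"
proof (induction n arbitrary: x)
  case (Suc n)
  show ?case
    using Suc[of "\<lambda>k. x (Suc k)"] by (auto simp: sum.lessThan_Suc_shift simp del: sum.lessThan_Suc)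
qed simp

lemma walk_max_mono_Suc: "walk_max n x \<le> walk_max (Suc n) x"
proof (induction n arbitrary: x)
  case (Suc n)
  show ?case
    using Suc[of "\<lambda>k. x (Suc k)"] by auto
qed simp

lemma walk_max_mono: "m \<le> n \<Longrightarrow> walk_max m x \<le> walk_max n x"
  by (rule lift_Suc_mono_le[of "\<lambda>n. walk_max n x"]) (rule walk_max_mono_Suc)

lemma measurable_walk_max:
  assumes "sets M = sets borel"
  shows "walk_max n \<in> borel_measurable (PiM UNIV (\<lambda>_::nat. M))"
proof (induction n)
  case (Suc n)
  have [measurable_cong]: "sets M = sets borel" by fact
  have [measurable]: "walk_max n \<in> borel_measurable (PiM UNIV (\<lambda>_::nat. M))" by fact
  have [measurable]: "(\<lambda>x k. x (Suc k)) \<in> measurable (PiM UNIV (\<lambda>_::nat. M)) (PiM UNIV (\<lambda>_::nat. M))"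
    by (rule measurable_PiM_single') (auto simp: space_PiM)
  show ?case by simp
qed simp

text \<open>
  Unlike positivity of some partial sum, unboundedness from above is invariant under the shift
  (\<open>unbounded_walk_case_nat\<close>).
\<close>

definition unbounded_walk :: "(nat \<Rightarrow> real) \<Rightarrow> bool" where
  "unbounded_walk x \<longleftrightarrow> (\<forall>K::nat. \<exists>n. real K < (\<Sum>i<n. x i))"

lemma unbounded_walk_case_nat: "unbounded_walk (case_nat s x) \<longleftrightarrow> unbounded_walk x"
proof
  assume u: "unbounded_walk (case_nat s x)"
  show "unbounded_walk x"
    unfolding unbounded_walk_def
  proof
    fix K :: nat
    obtain K' :: nat where K': "real K + \<bar>s\<bar> \<le> real K'" using real_arch_simple by blast
    obtain n where n: "real K' < (\<Sum>i<n. case_nat s x i)" using u unfolding unbounded_walk_def by blast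
    then obtain m where "n = Suc m" by (cases n) auto
    with n K' have "real K < (\<Sum>i<m. x i)"
      by (simp add: sum.lessThan_Suc_shift del: sum.lessThan_Suc)
    then show "\<exists>n. real K < (\<Sum>i<n. x i)" by blast
  qed
next
  assume u: "unbounded_walk x"
  show "unbounded_walk (case_nat s x)"
    unfolding unbounded_walk_def
  proof
    fix K :: nat
    obtain K' :: nat where K': "real K + \<bar>s\<bar> \<le> real K'" using real_arch_simple by blast
    obtain n where n: "real K' < (\<Sum>i<n. x i)" using u unfolding unbounded_walk_def by blast
    have "real K < (\<Sum>i<Suc n. case_nat s x i)"
      using n K' by (simp add: sum.lessThan_Suc_shift del: sum.lessThan_Suc)
    then show "\<exists>n. real K < (\<Sum>i<n. case_nat s x i)" by blast
  qed
qed

lemma walk_max_at_top: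
  assumes "unbounded_walk x"
  shows "filterlim (\<lambda>n. walk_max n x) at_top sequentially"
  unfolding filterlim_at_top
proof
  fix Z :: real
  obtain K :: nat where "Z \<le> real K" using real_arch_simple by blast
  moreover obtain n where "real K < (\<Sum>i<n. x i)" using assms unfolding unbounded_walk_def by blast
  ultimately have "Z \<le> walk_max n x" using sum_le_walk_max[of x n] by linarith
  then show "\<forall>\<^sub>F n in sequentially. Z \<le> walk_max n x"
    using walk_max_mono[of n _ x] by (intro eventually_sequentiallyI[of n]) (meson order_trans)
qed

text \<open>
  This is Garsia's maximal argument, restricted to the event \<open>B\<close> that the walk is unbounded. The
  maximum \<open>m n\<close> increases with \<open>n\<close> and \<open>m (n + 1)\<close> is \<open>max 0 (s + m n)\<close>, where \<open>s\<close> is the first increment and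
  the second \<open>m n\<close> is evaluated at the shifted walk. As the shift preserves the law and \<open>B\<close>, taking
  expectations on \<open>B\<close> yields \<open>0 \<le> E (max (- m n) s; B)\<close>. On \<open>B\<close> the maxima tend to infinity, so the
  limit is \<open>0 \<le> E (s; B)\<close>. Since \<open>B\<close> only depends on the later increments, the right-hand side is the drift
  times the probability of \<open>B\<close>, which must therefore vanish.
\<close>

proposition negative_drift_imp_bounded_above:
  assumes M: "prob_space M" "sets M = sets borel"
    and int: "integrable M (\<lambda>x::real. x)" and neg: "(\<integral>x. x \<partial>M) < 0"
  shows "AE x in PiM UNIV (\<lambda>_::nat. M). \<not> unbounded_walk x"
proof -
  interpret M: prob_space M by fact
  let ?S = "PiM UNIV (\<lambda>_::nat. M)"
  interpret S: prob_space ?S by (rule prob_space_PiM) (rule M)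
  interpret MS: pair_prob_space M ?S ..
  interpret sequence_space M ..
  have [measurable_cong]: "sets M = sets borel" by fact
  note [measurable] = measurable_walk_max[OF M(2)]
  have [measurable]: "Measurable.pred S unbounded_walk"
    unfolding unbounded_walk_def by measurable
  let ?B = "\<lambda>x. of_bool (unbounded_walk x) :: real"
  have shift: "(\<integral>x. f x \<partial>S) = (\<integral>z. f (case_nat (fst z) (snd z)) \<partial>(M \<Otimes>\<^sub>M S))"
    if "f \<in> borel_measurable S" for f :: "_ \<Rightarrow> real"
    using that by (subst PiM_iter[symmetric], subst integral_distr) (auto simp: split_beta')
  have shift_int: "integrable S f \<longleftrightarrow> integrable (M \<Otimes>\<^sub>M S) (\<lambda>z. f (case_nat (fst z) (snd z)))"
    if "f \<in> borel_measurable S" for f :: "_ \<Rightarrow> real"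
    using that by (subst PiM_iter[symmetric], subst integrable_distr_eq) (auto simp: split_beta')
  have snd_law: "distr (M \<Otimes>\<^sub>M S) S snd = S"
    using M.distr_pair_fst[of S]
    by (subst MS.distr_pair_swap, subst distr_distr) (auto simp: comp_def split_beta')
  have int_fst: "integrable (M \<Otimes>\<^sub>M S) (\<lambda>z. fst z)"
    using int by (subst (asm) S.distr_pair_fst[of M, symmetric], subst (asm) integrable_distr_eq) auto
  have int_snd: "integrable (M \<Otimes>\<^sub>M S) (\<lambda>z. f (snd z))" if "integrable S f" for f :: "_ \<Rightarrow> real"
    using that by (subst (asm) snd_law[symmetric], subst (asm) integrable_distr_eq) auto
  have int_max: "integrable S (walk_max n)" for n
  proof (induction n)
    case (Suc n)
    have "integrable (M \<Otimes>\<^sub>M S) (\<lambda>z. max 0 (fst z + walk_max n (snd z)))"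
      using int_fst int_snd[OF Suc] by (intro integrable_max) auto
    then show ?case by (subst shift_int) auto
  qed simp
  have step: "0 \<le> (\<integral>z. max (- walk_max n (snd z)) (fst z) * ?B (snd z) \<partial>(M \<Otimes>\<^sub>M S))" for n
  proof -
    have i: "integrable S (\<lambda>x. walk_max n x * ?B x)" for n
      by (rule Bochner_Integration.integrable_bound[OF int_max[of n]]) auto
    have "0 \<le> (\<integral>x. walk_max (Suc n) x * ?B x \<partial>S) - (\<integral>x. walk_max n x * ?B x \<partial>S)"
      using i[of n] i[of "Suc n"]
      by (auto intro!: integral_mono mult_right_mono walk_max_mono_Suc simp del: walk_max.simps)
    also have "(\<integral>x. walk_max (Suc n) x * ?B x \<partial>S)
        = (\<integral>z. max 0 (fst z + walk_max n (snd z)) * ?B (snd z) \<partial>(M \<Otimes>\<^sub>M S))"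
      by (subst shift) (measurable, simp add: unbounded_walk_case_nat)
    also have "(\<integral>x. walk_max n x * ?B x \<partial>S) = (\<integral>z. walk_max n (snd z) * ?B (snd z) \<partial>(M \<Otimes>\<^sub>M S))"
      by (subst snd_law[symmetric], subst integral_distr) auto
    also have "(\<integral>z. max 0 (fst z + walk_max n (snd z)) * ?B (snd z) \<partial>(M \<Otimes>\<^sub>M S))
       - (\<integral>z. walk_max n (snd z) * ?B (snd z) \<partial>(M \<Otimes>\<^sub>M S))
       = (\<integral>z. max 0 (fst z + walk_max n (snd z)) * ?B (snd z) - walk_max n (snd z) * ?B (snd z) \<partial>(M \<Otimes>\<^sub>M S))"
    proof (rule Bochner_Integration.integral_diff[symmetric])
      show "integrable (M \<Otimes>\<^sub>M S) (\<lambda>z. walk_max n (snd z) * ?B (snd z))"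
        by (rule int_snd[OF i])
      have "integrable (M \<Otimes>\<^sub>M S) (\<lambda>z. max 0 (fst z + walk_max n (snd z)))"
        using int_fst int_snd[OF int_max] by (intro integrable_max) auto
      then show "integrable (M \<Otimes>\<^sub>M S) (\<lambda>z. max 0 (fst z + walk_max n (snd z)) * ?B (snd z))"
        by (rule Bochner_Integration.integrable_bound) auto
    qed
    also have "\<dots> = (\<integral>z. max (- walk_max n (snd z)) (fst z) * ?B (snd z) \<partial>(M \<Otimes>\<^sub>M S))"
      by (intro Bochner_Integration.integral_cong) (auto simp: max_def algebra_simps)
    finally show ?thesis .
  qed
  have lim: "(\<lambda>n. \<integral>z. max (- walk_max n (snd z)) (fst z) * ?B (snd z) \<partial>(M \<Otimes>\<^sub>M S))
      \<longlonglongrightarrow> (\<integral>z. fst z * ?B (snd z) \<partial>(M \<Otimes>\<^sub>M S))"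
  proof (rule integral_dominated_convergence[where w="\<lambda>z. \<bar>fst z\<bar>"])
    show "integrable (M \<Otimes>\<^sub>M S) (\<lambda>z. \<bar>fst z\<bar>)" using int_fst by (rule integrable_abs)
    show "AE z in M \<Otimes>\<^sub>M S. (\<lambda>n. max (- walk_max n (snd z)) (fst z) * ?B (snd z)) \<longlonglongrightarrow> fst z * ?B (snd z)"
    proof (rule AE_I2, rule tendsto_eventually)
      fix z :: "real \<times> (nat \<Rightarrow> real)"
      show "\<forall>\<^sub>F n in sequentially. max (- walk_max n (snd z)) (fst z) * ?B (snd z) = fst z * ?B (snd z)"
      proof (cases "unbounded_walk (snd z)")
        case True
        have "\<forall>\<^sub>F n in sequentially. \<bar>fst z\<bar> \<le> walk_max n (snd z)"
          using walk_max_at_top[OF True] by (auto simp: filterlim_at_top)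
        then show ?thesis by eventually_elim (auto simp: max_def)
      qed auto
    qed
    show "AE z in M \<Otimes>\<^sub>M S. norm (max (- walk_max n (snd z)) (fst z) * ?B (snd z)) \<le> \<bar>fst z\<bar>" for n
    proof (rule AE_I2)
      fix z :: "real \<times> (nat \<Rightarrow> real)"
      have "0 \<le> walk_max n (snd z)" by (rule walk_max_nonneg)
      then have "\<bar>max (- walk_max n (snd z)) (fst z)\<bar> \<le> \<bar>fst z\<bar>" by linarith
      then show "norm (max (- walk_max n (snd z)) (fst z) * ?B (snd z)) \<le> \<bar>fst z\<bar>" by simp
    qed
  qed measurable
  have "0 \<le> (\<integral>z. fst z * ?B (snd z) \<partial>(M \<Otimes>\<^sub>M S))"
    by (rule LIMSEQ_le_const[OF lim]) (use step in auto)
  also have "\<dots> = (\<integral>s. \<integral>x. s * ?B x \<partial>S \<partial>M)"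
  proof -
    have "integrable (M \<Otimes>\<^sub>M S) (\<lambda>z. fst z * ?B (snd z))"
      by (rule Bochner_Integration.integrable_bound[OF int_fst]) auto
    from MS.integral_fst'[OF this] show ?thesis by simp
  qed
  also have "\<dots> = (\<integral>s. s \<partial>M) * S.prob {x\<in>space S. unbounded_walk x}"
  proof -
    have "(\<integral>x. ?B x \<partial>S) = S.prob {x\<in>space S. unbounded_walk x}"
      by (subst Bochner_Integration.integral_cong[OF refl, of _ _ "indicator {x\<in>space S. unbounded_walk x}"])
         (auto simp: indicator_def)
    then show ?thesis by simp
  qed
  finally have "S.prob {x\<in>space S. unbounded_walk x} = 0"
    using neg measure_nonneg[of S "{x\<in>space S. unbounded_walk x}"]
    by (auto simp: zero_le_mult_iff measure_le_0_iff)
  then show ?thesis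
    by (subst AE_iff_measurable[OF _ refl]) (auto simp: S.emeasure_eq_measure)
qed

text \<open>
  The upper half of the strong law of large numbers: subtracting a constant strictly between the mean
  and \<open>a\<close> from the summands makes the drift negative, and a bound on the resulting walk is
  eventually negligible against the remaining linear margin.
\<close>

proposition (in prob_space) iid_sum_eventually_le:
  fixes X :: "nat \<Rightarrow> 'a \<Rightarrow> real"
  assumes indep: "indep_vars (\<lambda>_. borel) X UNIV"
    and ident: "\<And>n. distr M borel (X n) = distr M borel (X 0)"
    and int: "integrable M (X 0)" and a: "expectation (X 0) < a"
  shows "AE \<omega> in M. \<forall>\<^sub>F n in sequentially. (\<Sum>i<n. X i \<omega>) \<le> real n * a"
proof -
  define b where "b = (expectation (X 0) + a) / 2"
  have b: "expectation (X 0) < b" "b < a" using a by (auto simp: b_def)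
  have rv[measurable]: "X n \<in> borel_measurable M" for n
    using indep by (auto simp: indep_vars_def)
  define Y where "Y n \<omega> = X n \<omega> - b" for n \<omega>
  have [measurable]: "Y n \<in> borel_measurable M" for n unfolding Y_def by simp
  have Y0: "Y 0 = (\<lambda>\<omega>. X 0 \<omega> - b)" by (auto simp: Y_def)
  have Yid: "distr M borel (Y n) = distr M borel (Y 0)" for n
  proof -
    have "distr M borel (Y n) = distr (distr M borel (X n)) borel (\<lambda>x. x - b)" for n
      unfolding Y_def by (subst distr_distr) (auto simp: comp_def)
    then show ?thesis using ident by metis
  qed
  have "indep_vars (\<lambda>_. borel) Y UNIV"
    unfolding Y_def by (rule indep_vars_compose2[OF indep]) auto
  then have PiM: "distr M (PiM UNIV (\<lambda>_. borel)) (\<lambda>\<omega>. \<lambda>i\<in>UNIV. Y i \<omega>) = PiM UNIV (\<lambda>_. distr M borel (Y 0))"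
    by (subst (asm) indep_vars_iff_distr_eq_PiM) (auto intro!: PiM_cong Yid)
  have "AE x in PiM UNIV (\<lambda>_::nat. distr M borel (Y 0)). \<not> unbounded_walk x"
  proof (rule negative_drift_imp_bounded_above)
    show "prob_space (distr M borel (Y 0))" by (rule prob_space_distr) simp
    show "integrable (distr M borel (Y 0)) (\<lambda>x. x)"
      using int by (subst integrable_distr_eq) (auto simp: Y0)
    show "(\<integral>x. x \<partial>distr M borel (Y 0)) < 0"
      using int b by (subst integral_distr) (auto simp: Y0 prob_space)
  qed simp
  moreover have meas: "(\<lambda>\<omega>. \<lambda>i\<in>UNIV. Y i \<omega>) \<in> measurable M (PiM UNIV (\<lambda>_::nat. borel))"
    by measurable
  ultimately have "AE x in distr M (PiM UNIV (\<lambda>_. borel)) (\<lambda>\<omega>. \<lambda>i\<in>UNIV. Y i \<omega>). \<not> unbounded_walk x"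
    unfolding PiM by simp
  then have "AE \<omega> in M. \<not> unbounded_walk (\<lambda>i. Y i \<omega>)"
    using AE_distrD[OF meas] by (simp add: restrict_UNIV)
  then show ?thesis
  proof eventually_elim
    fix \<omega> assume "\<not> unbounded_walk (\<lambda>i. Y i \<omega>)"
    then obtain K :: nat where K: "(\<Sum>i<n. Y i \<omega>) \<le> real K" for n
      unfolding unbounded_walk_def by (auto simp: not_less)
    obtain N :: nat where N: "real K / (a - b) \<le> real N" using real_arch_simple by blast
    show "\<forall>\<^sub>F n in sequentially. (\<Sum>i<n. X i \<omega>) \<le> real n * a"
    proof (rule eventually_sequentiallyI[of N])
      fix n assume "N \<le> n"
      then have "real K / (a - b) \<le> real n" using N by linarith
      then have "real K \<le> real n * (a - b)" using b by (simp add: field_simps)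
      moreover have "(\<Sum>i<n. X i \<omega>) = (\<Sum>i<n. Y i \<omega>) + real n * b"
        by (simp add: Y_def sum_subtractf)
      ultimately show "(\<Sum>i<n. X i \<omega>) \<le> real n * a"
        using K[of n] by (simp add: algebra_simps)
    qed
  qed
qed

section \<open>Expected logarithms\<close>

lemma measurable_elog[measurable]: "elog \<in> borel_measurable borel"
  unfolding elog_def[abs_def] by measurable

lemma elog_mono: "0 \<le> x \<Longrightarrow> x \<le> y \<Longrightarrow> elog x \<le> elog y"
  by (auto simp: elog_def)

lemma tendsto_elog:
  assumes lim: "(x \<longlongrightarrow> l) F" and nonneg: "\<And>k. 0 \<le> x k"
  shows "((\<lambda>k. elog (x k)) \<longlongrightarrow> elog l) F"
proof (cases "F = bot")
  case F: False
  have "0 \<le> l" using tendsto_lowerbound[OF lim] nonneg F by auto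
  show ?thesis
  proof (cases "l = 0")
    case False
    then have pos: "0 < l" using \<open>0 \<le> l\<close> by simp
    have "((\<lambda>k. ereal (ln (x k))) \<longlongrightarrow> ereal (ln l)) F"
      using lim pos by (intro tendsto_intros) auto
    moreover have "\<forall>\<^sub>F k in F. 0 < x k" using order_tendstoD(1)[OF lim pos] .
    then have "\<forall>\<^sub>F k in F. ereal (ln (x k)) = elog (x k)"
      by eventually_elim (auto simp: elog_def)
    ultimately show ?thesis
      using pos by (auto simp: elog_def[of l] intro: Lim_transform_eventually)
  next
    case True
    show ?thesis
      unfolding True elog_def[of 0] if_P[OF refl] tendsto_MInfty
    proof
      fix r :: real
      have "\<forall>\<^sub>F k in F. x k < exp r" using order_tendstoD(2)[OF lim, of "exp r"] True by simp
      then show "\<forall>\<^sub>F k in F. elog (x k) < ereal r"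
      proof eventually_elim
        fix k assume k: "x k < exp r"
        show "elog (x k) < ereal r"
        proof (cases "x k = 0")
          case False
          then have "0 < x k" using nonneg[of k] by simp
          then have "ln (x k) < r" using k by (metis exp_less_cancel_iff exp_ln)
          then show ?thesis using False by (simp add: elog_def)
        qed (simp add: elog_def)
      qed
    qed
  qed
qed simp

lemma ereal_expectation_integrable:
  assumes "integrable M f"
  shows "ereal_expectation M (\<lambda>x. ereal (f x)) = ereal (\<integral>x. f x \<partial>M)"
proof -
  obtain r q where rq: "0 \<le> r" "0 \<le> q" "(\<integral>\<^sup>+x. ennreal (f x) \<partial>M) = ennreal r" "(\<integral>\<^sup>+x. ennreal (- f x) \<partial>M) = ennreal q"
    "(\<integral>x. f x \<partial>M) = r - q"
    using integrableE[OF assms] by metis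
  then show ?thesis by (simp add: ereal_expectation_def)
qed

lemma ereal_expectation_cong_AE:
  assumes "AE x in M. f x = g x"
  shows "ereal_expectation M f = ereal_expectation M g"
  unfolding ereal_expectation_def
  using assms by (intro arg_cong2[where f="(-)"] arg_cong[where f=enn2ereal] nn_integral_cong_AE) auto

text \<open>
  Below an integrable function \<open>u\<close>, the expectation is determined by the nonnegative deficit \<open>u - f\<close>, to
  which monotonicity and Fatou's lemma apply even if the expectation is \<open>-\<infinity>\<close>.
\<close>

lemma ereal_expectation_dominated:
  assumes u: "integrable M u" and [measurable]: "f \<in> borel_measurable M"
    and le: "\<And>x. x \<in> space M \<Longrightarrow> f x \<le> ereal (u x)"
  shows "ereal_expectation M f =
    ereal (\<integral>x. u x \<partial>M) - enn2ereal (\<integral>\<^sup>+x. e2ennreal (ereal (u x) - f x) \<partial>M)"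
proof -
  have [measurable]: "u \<in> borel_measurable M" using u by auto
  obtain r q where rq: "0 \<le> r" "0 \<le> q" "(\<integral>\<^sup>+x. ennreal (u x) \<partial>M) = ennreal r" "(\<integral>\<^sup>+x. ennreal (- u x) \<partial>M) = ennreal q"
    "(\<integral>x. u x \<partial>M) = r - q"
    using integrableE[OF u] by metis
  define A where "A = (\<integral>\<^sup>+x. e2ennreal (f x) \<partial>M)"
  define B where "B = (\<integral>\<^sup>+x. e2ennreal (- f x) \<partial>M)"
  define G where "G = (\<integral>\<^sup>+x. e2ennreal (ereal (u x) - f x) \<partial>M)"
  have "A \<le> (\<integral>\<^sup>+x. ennreal (u x) \<partial>M)"
    unfolding A_def using le by (intro nn_integral_mono) (metis e2ennreal_ereal e2ennreal_mono)
  then have Afin: "A < \<infinity>" using rq by (auto simp: le_less_trans)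
  \<comment> \<open>This is \<open>A + G - B = r - q\<close>, written without subtraction of possibly infinite values.\<close>
  have "A + G + ennreal q = (\<integral>\<^sup>+x. e2ennreal (f x) + e2ennreal (ereal (u x) - f x) + ennreal (- u x) \<partial>M)"
    unfolding A_def G_def rq(4)[symmetric] by (simp add: nn_integral_add)
  also have "\<dots> = (\<integral>\<^sup>+x. e2ennreal (- f x) + ennreal (u x) \<partial>M)"
  proof (rule nn_integral_cong)
    fix x assume "x \<in> space M"
    then have "f x \<le> ereal (u x)" by (rule le)
    then show "e2ennreal (f x) + e2ennreal (ereal (u x) - f x) + ennreal (- u x) = e2ennreal (- f x) + ennreal (u x)"
    proof (cases "f x")
      case (real v)
      then have "v \<le> u x" using \<open>f x \<le> ereal (u x)\<close> by simp
      then show ?thesis unfolding real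
        by (cases "0 \<le> v"; cases "0 \<le> u x")
           (auto simp: ennreal_neg ennreal_plus[symmetric] simp del: ennreal_plus)
    qed auto
  qed
  also have "\<dots> = B + ennreal r"
    unfolding B_def rq(3)[symmetric] by (subst nn_integral_add) auto
  finally have *: "A + G + ennreal q = B + ennreal r" .
  have "enn2ereal A - enn2ereal B = ereal (r - q) - enn2ereal G"
  proof (cases "G = \<infinity>")
    case True
    then have "B = \<infinity>" using * by (cases B) (auto simp: ennreal_plus[symmetric] rq simp del: ennreal_plus)
    with True Afin show ?thesis by (cases A) auto
  next
    case False
    obtain a g where a: "A = ennreal a" "0 \<le> a" and g: "G = ennreal g" "0 \<le> g"
      using Afin False by (metis ennreal_cases infinity_ennreal_def less_irrefl)
    have "B \<noteq> \<infinity>" using * by (auto simp: a g rq ennreal_plus[symmetric] simp del: ennreal_plus)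
    then obtain b where b: "B = ennreal b" "0 \<le> b" by (cases B) auto
    have "a + g + q = b + r"
      using * a g b rq(1,2) by (simp add: ennreal_plus[symmetric] del: ennreal_plus)
    then show ?thesis using a g b by simp
  qed
  then show ?thesis unfolding ereal_expectation_def A_def B_def G_def rq(5) by simp
qed

text \<open>
  This turns an extended expectation with known upper bound and finite negative part into an ordinary
  integral, so that differences of growth rates can be computed.
\<close>

lemma ereal_expectation_elog_finite:
  assumes [measurable]: "Z \<in> borel_measurable M" and nonneg: "\<And>x. x \<in> space M \<Longrightarrow> 0 \<le> Z x"
    and fin: "(\<integral>\<^sup>+x. e2ennreal (- elog (Z x)) \<partial>M) < \<infinity>" "ereal_expectation M (\<lambda>x. elog (Z x)) < \<infinity>"
  shows "AE x in M. 0 < Z x" and "integrable M (\<lambda>x. ln (Z x))"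
    and "ereal_expectation M (\<lambda>x. elog (Z x)) = ereal (\<integral>x. ln (Z x) \<partial>M)"
proof -
  have "AE x in M. e2ennreal (- elog (Z x)) \<noteq> \<infinity>"
    using fin by (intro nn_integral_noteq_infinite) auto
  then show pos: "AE x in M. 0 < Z x"
    using AE_space by eventually_elim (use nonneg in \<open>force simp: elog_def less_le\<close>)
  then have eq: "AE x in M. elog (Z x) = ereal (ln (Z x))"
    by eventually_elim (auto simp: elog_def)
  have n: "(\<integral>\<^sup>+x. ennreal (- ln (Z x)) \<partial>M) = (\<integral>\<^sup>+x. e2ennreal (- elog (Z x)) \<partial>M)"
    using eq by (intro nn_integral_cong_AE) auto
  have p: "(\<integral>\<^sup>+x. ennreal (ln (Z x)) \<partial>M) = (\<integral>\<^sup>+x. e2ennreal (elog (Z x)) \<partial>M)"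
    using eq by (intro nn_integral_cong_AE) auto
  have "(\<integral>\<^sup>+x. e2ennreal (elog (Z x)) \<partial>M) \<noteq> \<infinity>"
  proof
    assume "(\<integral>\<^sup>+x. e2ennreal (elog (Z x)) \<partial>M) = \<infinity>"
    \<comment> \<open>The difference would be \<open>\<infinity>\<close>, as the negative part is finite.\<close>
    then show False using fin unfolding ereal_expectation_def
      by (cases "(\<integral>\<^sup>+x. e2ennreal (- elog (Z x)) \<partial>M)") auto
  qed
  then show int: "integrable M (\<lambda>x. ln (Z x))"
    using fin(1) by (simp add: real_integrable_def n p)
  show "ereal_expectation M (\<lambda>x. elog (Z x)) = ereal (\<integral>x. ln (Z x) \<partial>M)"
    using ereal_expectation_cong_AE[OF eq] ereal_expectation_integrable[OF int] by simp
qed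


section \<open>Growth-optimal portfolios\<close>

lemma axis_in_prob_simplex: "axis j 1 \<in> prob_simplex"
  by (auto simp: prob_simplex_def axis_def)

lemma uniform_in_prob_simplex: "(\<chi> j. 1 / real CARD('d option)) \<in> (prob_simplex :: (real ^ 'd::finite option) set)"
  by (auto simp: prob_simplex_def)

lemma prob_simplex_segment:
  assumes "l \<in> prob_simplex" "l' \<in> prob_simplex" "0 \<le> t" "t \<le> 1"
  shows "(1 - t) *\<^sub>R l + t *\<^sub>R l' \<in> prob_simplex"
proof -
  have "(1 - t) * l $ j + t * l' $ j \<le> 1" for j
    using assms by (intro convex_bound_le) (auto simp: prob_simplex_def)
  moreover have "(\<Sum>j\<in>UNIV. (1 - t) * l $ j + t * l' $ j) = 1"
    using assms by (simp add: sum.distrib sum_distrib_left[symmetric] prob_simplex_def)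
  ultimately show ?thesis using assms by (auto simp: prob_simplex_def)
qed

lemma compact_prob_simplex: "compact (prob_simplex :: (real ^ 'd::finite option) set)"
proof -
  have "prob_simplex = (\<Inter>j. {l. 0 \<le> l $ j} \<inter> {l. l $ j \<le> 1}) \<inter> {l :: real ^ 'd option. (\<Sum>j\<in>UNIV. l $ j) = 1}"
    by (auto simp: prob_simplex_def)
  moreover have "closed \<dots>"
    by (intro closed_Int closed_INT ballI closed_Collect_le closed_Collect_eq continuous_intros)
  moreover have "bounded (prob_simplex :: (real ^ 'd option) set)"
    by (rule bounded_subset[OF bounded_cbox[of 0 1]]) (auto simp: mem_box_cart prob_simplex_def)
  ultimately show ?thesis by (simp add: compact_eq_bounded_closed)
qed

locale payoff_vector = prob_space M for M :: "'a measure" +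
  fixes V :: "'a \<Rightarrow> real ^ 'd::finite option"
  assumes measurable_V[measurable]: "V \<in> borel_measurable M"
    and V_nonneg: "\<And>\<omega> j. \<omega> \<in> space M \<Longrightarrow> 0 \<le> V \<omega> $ j"
    and V_None: "\<And>\<omega>. \<omega> \<in> space M \<Longrightarrow> V \<omega> $ None = 1"
begin

definition growth :: "real ^ 'd option \<Rightarrow> ereal" where
  "growth l = ereal_expectation M (\<lambda>\<omega>. elog (l \<bullet> V \<omega>))"

lemma measurable_V_nth[measurable]: "(\<lambda>\<omega>. V \<omega> $ j) \<in> borel_measurable M"
proof -
  have "(\<lambda>\<omega>. V \<omega> \<bullet> axis j 1) \<in> borel_measurable M"
    by (intro borel_measurable_inner measurable_V measurable_const) simp
  then show ?thesis by (simp add: inner_axis)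
qed

lemma measurable_payoff[measurable]: "(\<lambda>\<omega>. l \<bullet> V \<omega>) \<in> borel_measurable M"
  by (intro borel_measurable_inner measurable_V measurable_const) simp

lemma payoff_nonneg: "l \<in> prob_simplex \<Longrightarrow> \<omega> \<in> space M \<Longrightarrow> 0 \<le> l \<bullet> V \<omega>"
  by (auto simp: inner_vec_def prob_simplex_def intro!: sum_nonneg mult_nonneg_nonneg V_nonneg)

lemma payoff_le_sum: "l \<in> prob_simplex \<Longrightarrow> \<omega> \<in> space M \<Longrightarrow> l \<bullet> V \<omega> \<le> (\<Sum>j\<in>UNIV. V \<omega> $ j)"
  by (auto simp: inner_vec_def prob_simplex_def intro!: sum_mono mult_left_le_one_le V_nonneg)

lemma one_le_sum_V: "\<omega> \<in> space M \<Longrightarrow> 1 \<le> (\<Sum>j\<in>UNIV. V \<omega> $ j)"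
  using member_le_sum[of None UNIV "\<lambda>j. V \<omega> $ j"] by (auto simp: V_None V_nonneg)

text \<open>
  The payoff of the uniform weights is a fixed multiple of the sum of all coordinates and is bounded
  away from \<open>0\<close>, so its logarithm has a finite negative part and a positive part with the same
  integrability as the logarithm of the sum.
\<close>

lemma growth_uniform_infinite:
  assumes "\<not> integrable M (\<lambda>\<omega>. ln (\<Sum>j\<in>UNIV. V \<omega> $ j))"
  shows "growth (\<chi> j. 1 / real CARD('d option)) = \<infinity>"
proof -
  let ?s = "\<lambda>\<omega>. \<Sum>j\<in>UNIV. V \<omega> $ j"
  define c where "c = real CARD('d option)"
  have c: "1 \<le> c" by (simp add: c_def)
  have eq: "elog ((\<chi> j. 1 / c) \<bullet> V \<omega>) = ereal (ln (?s \<omega>) - ln c)" if "\<omega> \<in> space M" for \<omega>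
  proof -
    have "(\<chi> j. 1 / c) \<bullet> V \<omega> = ?s \<omega> / c"
      by (simp add: inner_vec_def sum_divide_distrib)
    then show ?thesis
      using one_le_sum_V[OF that] c by (simp add: elog_def ln_div)
  qed
  have inf: "(\<integral>\<^sup>+\<omega>. ennreal (ln (?s \<omega>)) \<partial>M) = \<infinity>"
  proof (rule ccontr)
    assume "\<not> ?thesis"
    then have "integrable M (\<lambda>\<omega>. ln (?s \<omega>))"
      by (intro integrableI_nonneg) (measurable, auto intro!: AE_I2 ln_ge_zero one_le_sum_V simp: less_top)
    with assms show False ..
  qed
  have "(\<integral>\<^sup>+\<omega>. ennreal (ln (?s \<omega>)) \<partial>M) \<le> (\<integral>\<^sup>+\<omega>. ennreal (ln (?s \<omega>) - ln c) + ennreal (ln c) \<partial>M)"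
  proof (rule nn_integral_mono)
    fix \<omega>
    show "ennreal (ln (?s \<omega>)) \<le> ennreal (ln (?s \<omega>) - ln c) + ennreal (ln c)"
      using c by (cases "ln c \<le> ln (?s \<omega>)")
         (auto simp: ennreal_plus[symmetric] ennreal_neg intro!: ennreal_leI simp del: ennreal_plus)
  qed
  also have "\<dots> = (\<integral>\<^sup>+\<omega>. ennreal (ln (?s \<omega>) - ln c) \<partial>M) + ennreal (ln c)"
    by (subst nn_integral_add) (auto simp: emeasure_space_1)
  finally have A: "(\<integral>\<^sup>+\<omega>. ennreal (ln (?s \<omega>) - ln c) \<partial>M) = \<infinity>"
    unfolding inf by (simp add: top_unique)
  have "(\<integral>\<^sup>+\<omega>. ennreal (- (ln (?s \<omega>) - ln c)) \<partial>M) \<le> (\<integral>\<^sup>+\<omega>. ennreal (ln c) \<partial>M)"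
    by (intro nn_integral_mono ennreal_leI) (auto dest: one_le_sum_V)
  also have "\<dots> < \<infinity>" by (simp add: emeasure_space_1)
  finally have B: "(\<integral>\<^sup>+\<omega>. ennreal (- (ln (?s \<omega>) - ln c)) \<partial>M) \<noteq> \<infinity>" by simp
  have "growth (\<chi> j. 1 / c) = enn2ereal (\<integral>\<^sup>+\<omega>. ennreal (ln (?s \<omega>) - ln c) \<partial>M)
     - enn2ereal (\<integral>\<^sup>+\<omega>. ennreal (- (ln (?s \<omega>) - ln c)) \<partial>M)"
    unfolding growth_def ereal_expectation_def
    by (intro arg_cong2[where f="(-)"] arg_cong[where f=enn2ereal] nn_integral_cong) (simp_all add: eq)
  then show ?thesis
    unfolding c_def[symmetric] using A B by (cases "(\<integral>\<^sup>+\<omega>. ennreal (- (ln (?s \<omega>) - ln c)) \<partial>M)") auto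
qed

text \<open>
  Since every payoff is at most the sum of all coordinates, the integrand is nonnegative; it is \<open>\<infinity>\<close>
  where the payoff vanishes.
\<close>

definition growth_gap :: "real ^ 'd option \<Rightarrow> ennreal" where
  "growth_gap l = (\<integral>\<^sup>+\<omega>. e2ennreal (ereal (ln (\<Sum>j\<in>UNIV. V \<omega> $ j)) - elog (l \<bullet> V \<omega>)) \<partial>M)"

lemma growth_eq_diff_gap:
  assumes int: "integrable M (\<lambda>\<omega>. ln (\<Sum>j\<in>UNIV. V \<omega> $ j))" and l: "l \<in> prob_simplex"
  shows "growth l = ereal (\<integral>\<omega>. ln (\<Sum>j\<in>UNIV. V \<omega> $ j) \<partial>M) - enn2ereal (growth_gap l)"
  unfolding growth_def growth_gap_def
proof (rule ereal_expectation_dominated[OF int])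
  fix \<omega> assume \<omega>: "\<omega> \<in> space M"
  have "elog (l \<bullet> V \<omega>) \<le> elog (\<Sum>j\<in>UNIV. V \<omega> $ j)"
    using l \<omega> by (intro elog_mono payoff_nonneg payoff_le_sum)
  also have "\<dots> = ereal (ln (\<Sum>j\<in>UNIV. V \<omega> $ j))"
    using one_le_sum_V[OF \<omega>] by (auto simp: elog_def)
  finally show "elog (l \<bullet> V \<omega>) \<le> ereal (ln (\<Sum>j\<in>UNIV. V \<omega> $ j))" .
qed measurable

lemma growth_gap_lower_semicontinuous:
  assumes lim: "l \<longlonglongrightarrow> l0" and l: "\<And>k. l k \<in> prob_simplex"
  shows "growth_gap l0 \<le> liminf (\<lambda>k. growth_gap (l k))"
proof -
  let ?u = "\<lambda>\<omega>. ereal (ln (\<Sum>j\<in>UNIV. V \<omega> $ j))"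
  have "(\<lambda>k. e2ennreal (?u \<omega> - elog (l k \<bullet> V \<omega>))) \<longlonglongrightarrow> e2ennreal (?u \<omega> - elog (l0 \<bullet> V \<omega>))"
    if "\<omega> \<in> space M" for \<omega>
  proof (intro tendsto_e2ennrealI tendsto_diff_ereal_general tendsto_const)
    show "(\<lambda>k. elog (l k \<bullet> V \<omega>)) \<longlonglongrightarrow> elog (l0 \<bullet> V \<omega>)"
      by (intro tendsto_elog tendsto_intros lim payoff_nonneg l that)
  qed auto
  then have "growth_gap l0 = (\<integral>\<^sup>+\<omega>. liminf (\<lambda>k. e2ennreal (?u \<omega> - elog (l k \<bullet> V \<omega>))) \<partial>M)"
    unfolding growth_gap_def by (intro nn_integral_cong lim_imp_Liminf[symmetric]) simp_all
  also have "\<dots> \<le> liminf (\<lambda>k. growth_gap (l k))"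
    unfolding growth_gap_def by (rule nn_integral_liminf) measurable
  finally show ?thesis .
qed

text \<open>
  A minimising sequence has a convergent subsequence, whose limit is a minimiser by lower
  semicontinuity.
\<close>

lemma growth_gap_attains_min: "\<exists>l\<in>prob_simplex. \<forall>l'\<in>prob_simplex. growth_gap l \<le> growth_gap l'"
proof -
  have "growth_gap ` prob_simplex \<noteq> {}" using axis_in_prob_simplex by auto
  from ennreal_Inf_countable_INF[OF this] obtain f :: "nat \<Rightarrow> ennreal" where
    f: "decseq f" "range f \<subseteq> growth_gap ` prob_simplex" "Inf (growth_gap ` prob_simplex) = (INF i. f i)"
    by blast
  have "\<forall>k. \<exists>l. l \<in> prob_simplex \<and> growth_gap l = f k"
    using f(2) by (auto simp: image_iff subset_iff) metis
  then obtain l where l: "\<And>k. l k \<in> prob_simplex" "\<And>k. growth_gap (l k) = f k"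
    by metis
  obtain l0 r where r: "l0 \<in> prob_simplex" "strict_mono r" "(l \<circ> r) \<longlonglongrightarrow> l0"
    using compact_prob_simplex l(1) unfolding compact_def by metis
  have "f \<longlonglongrightarrow> Inf (growth_gap ` prob_simplex)" unfolding f(3) by (rule LIMSEQ_INF[OF f(1)])
  then have "(\<lambda>k. growth_gap ((l \<circ> r) k)) \<longlonglongrightarrow> Inf (growth_gap ` prob_simplex)"
    using LIMSEQ_subseq_LIMSEQ[OF _ r(2)] by (auto simp: l(2) comp_def)
  then have "liminf (\<lambda>k. growth_gap ((l \<circ> r) k)) = Inf (growth_gap ` prob_simplex)"
    by (intro lim_imp_Liminf) auto
  moreover have "growth_gap l0 \<le> liminf (\<lambda>k. growth_gap ((l \<circ> r) k))"
    by (rule growth_gap_lower_semicontinuous[OF r(3)]) (simp add: l(1))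
  ultimately show ?thesis
    using r(1) by (metis INF_lower order_trans)
qed

proposition growth_attains_max: "\<exists>l\<in>prob_simplex. \<forall>l'\<in>prob_simplex. growth l' \<le> growth l"
proof (cases "integrable M (\<lambda>\<omega>. ln (\<Sum>j\<in>UNIV. V \<omega> $ j))")
  case True
  obtain l where l: "l \<in> prob_simplex" "\<And>l'. l' \<in> prob_simplex \<Longrightarrow> growth_gap l \<le> growth_gap l'"
    using growth_gap_attains_min by blast
  have "growth l' \<le> growth l" if "l' \<in> prob_simplex" for l'
    using l(2)[OF that] that l(1)
    by (auto simp: growth_eq_diff_gap[OF True] less_eq_ennreal.rep_eq intro!: ereal_minus_mono)
  with l(1) show ?thesis by blast
next
  case False
  show ?thesis
    using growth_uniform_infinite[OF False] uniform_in_prob_simplex by (metis ereal_less_eq(1))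
qed


text \<open>
  Keeping everything on coordinate \<open>0\<close> pays \<open>1\<close>, hence a maximal growth rate is never negative.
\<close>

lemma growth_bank: "growth (axis None 1) = 0"
proof -
  have "growth (axis None 1) = ereal_expectation M (\<lambda>\<omega>. ereal 0)"
    unfolding growth_def by (rule ereal_expectation_cong_AE) (simp add: V_None inner_axis' elog_def)
  also have "\<dots> = ereal (\<integral>\<omega>. 0 \<partial>M)" by (rule ereal_expectation_integrable) simp
  finally show ?thesis by (simp add: zero_ereal_def)
qed

lemma growth_finite:
  assumes l: "l \<in> prob_simplex" and fin: "0 \<le> growth l" "growth l < \<infinity>"
  shows "AE \<omega> in M. 0 < l \<bullet> V \<omega>" and "integrable M (\<lambda>\<omega>. ln (l \<bullet> V \<omega>))"
    and "growth l = ereal (\<integral>\<omega>. ln (l \<bullet> V \<omega>) \<partial>M)"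
proof -
  have "(\<integral>\<^sup>+\<omega>. e2ennreal (- elog (l \<bullet> V \<omega>)) \<partial>M) < \<infinity>"
  proof (rule ccontr)
    assume "\<not> ?thesis"
    then have "(\<integral>\<^sup>+\<omega>. e2ennreal (- elog (l \<bullet> V \<omega>)) \<partial>M) = \<infinity>" by (simp add: not_less top_unique)
    \<comment> \<open>An infinite negative part makes the expectation \<open>-\<infinity>\<close>, or \<open>\<infinity>\<close> if the positive part is infinite too,
    because \<open>\<infinity> - \<infinity> = \<infinity>\<close> in \<open>ereal\<close>.\<close>
    then show False
      using fin unfolding growth_def ereal_expectation_def
      by (cases "(\<integral>\<^sup>+\<omega>. e2ennreal (elog (l \<bullet> V \<omega>)) \<partial>M)") auto
  qed
  note * = ereal_expectation_elog_finite[OF _ payoff_nonneg[OF l] this fin(2)[unfolded growth_def]]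
  show "AE \<omega> in M. 0 < l \<bullet> V \<omega>" by (rule *(1)) measurable
  show "integrable M (\<lambda>\<omega>. ln (l \<bullet> V \<omega>))" by (rule *(2)) measurable
  show "growth l = ereal (\<integral>\<omega>. ln (l \<bullet> V \<omega>) \<partial>M)" unfolding growth_def by (rule *(3)) measurable
qed

text \<open>
  First-order optimality. With \<open>R = V j / (l \<bullet> V)\<close>, replacing \<open>l\<close> by \<open>(1 - t) l + t e\<^sub>j\<close> changes the
  logarithm of the payoff by \<open>ln (1 + t (R - 1))\<close>, whose expectation is at most \<open>0\<close> by maximality.
  Dividing by \<open>t\<close> and letting \<open>t\<close> tend to \<open>0\<close> gives \<open>E (R - 1) \<le> 0\<close>. The limit may be taken inside by
  Fatou's lemma because the difference quotients are at least \<open>-2\<close> for \<open>t \<le> 1 / 2\<close>; the constant \<open>2\<close>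
  is added to make them nonnegative.
\<close>

proposition growth_maximiser_numeraire:
  assumes l: "l \<in> prob_simplex" and max: "\<And>l'. l' \<in> prob_simplex \<Longrightarrow> growth l' \<le> growth l"
    and fin: "growth l < \<infinity>"
  shows "(\<integral>\<^sup>+\<omega>. ennreal (V \<omega> $ j / (l \<bullet> V \<omega>)) \<partial>M) \<le> 1"
proof -
  have "0 \<le> growth l" using max[OF axis_in_prob_simplex[of None]] by (simp add: growth_bank)
  note F = growth_finite[OF l this fin]
  define R where "R \<omega> = V \<omega> $ j / (l \<bullet> V \<omega>)" for \<omega>
  have [measurable]: "R \<in> borel_measurable M" unfolding R_def by measurable
  have R_nonneg: "0 \<le> R \<omega>" if "\<omega> \<in> space M" for \<omega>
    unfolding R_def using that by (intro divide_nonneg_nonneg V_nonneg payoff_nonneg l)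
  define D where "D t \<omega> = ln (1 + t * (R \<omega> - 1)) / t" for t \<omega>
  have [measurable]: "D t \<in> borel_measurable M" for t unfolding D_def by measurable
  have bound: "(\<integral>\<^sup>+\<omega>. ennreal (D t \<omega> + 2) \<partial>M) \<le> 2" if t: "0 < t" "t \<le> 1 / 2" for t
  proof -
    define lt where "lt = (1 - t) *\<^sub>R l + t *\<^sub>R axis j 1"
    have lt: "lt \<in> prob_simplex"
      unfolding lt_def using t by (intro prob_simplex_segment l axis_in_prob_simplex) auto
    have ltV: "lt \<bullet> V \<omega> = (1 - t) * (l \<bullet> V \<omega>) + t * V \<omega> $ j" for \<omega>
      by (simp add: lt_def inner_add_left inner_axis')
    have "AE \<omega> in M. e2ennreal (- elog (lt \<bullet> V \<omega>)) \<le> ennreal (- ln (l \<bullet> V \<omega>)) + ennreal (- ln (1 - t))"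
      using F(1) AE_space
    proof eventually_elim
      fix \<omega> assume *: "0 < l \<bullet> V \<omega>" "\<omega> \<in> space M"
      have "0 < (1 - t) * (l \<bullet> V \<omega>)" using * t by simp
      moreover have le: "(1 - t) * (l \<bullet> V \<omega>) \<le> lt \<bullet> V \<omega>" unfolding ltV using V_nonneg[OF *(2)] t by simp
      ultimately have pos: "0 < lt \<bullet> V \<omega>" by linarith
      have "ln (1 - t) + ln (l \<bullet> V \<omega>) = ln ((1 - t) * (l \<bullet> V \<omega>))"
        using * t by (simp add: ln_mult)
      also have "\<dots> \<le> ln (lt \<bullet> V \<omega>)" using le * t pos by simp
      finally have "ennreal (- ln (lt \<bullet> V \<omega>)) \<le> ennreal (- ln (l \<bullet> V \<omega>) + - ln (1 - t))"
        by (intro ennreal_leI) simp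
      also have "\<dots> \<le> ennreal (- ln (l \<bullet> V \<omega>)) + ennreal (- ln (1 - t))"
        using t by (cases "0 \<le> - ln (l \<bullet> V \<omega>)")
          (auto simp: ennreal_neg ennreal_plus[symmetric] intro!: ennreal_leI simp del: ennreal_plus)
      finally show "e2ennreal (- elog (lt \<bullet> V \<omega>)) \<le> ennreal (- ln (l \<bullet> V \<omega>)) + ennreal (- ln (1 - t))"
        using pos by (simp add: elog_def)
    qed
    then have "(\<integral>\<^sup>+\<omega>. e2ennreal (- elog (lt \<bullet> V \<omega>)) \<partial>M)
        \<le> (\<integral>\<^sup>+\<omega>. ennreal (- ln (l \<bullet> V \<omega>)) + ennreal (- ln (1 - t)) \<partial>M)"
      by (rule nn_integral_mono_AE)
    also have "\<dots> = (\<integral>\<^sup>+\<omega>. ennreal (- ln (l \<bullet> V \<omega>)) \<partial>M) + ennreal (- ln (1 - t))"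
      by (simp add: nn_integral_add emeasure_space_1)
    also have "\<dots> < \<infinity>" using F(2) by (simp add: real_integrable_def less_top)
    finally have neg: "(\<integral>\<^sup>+\<omega>. e2ennreal (- elog (lt \<bullet> V \<omega>)) \<partial>M) < \<infinity>" .
    have "ereal_expectation M (\<lambda>\<omega>. elog (lt \<bullet> V \<omega>)) < \<infinity>"
      using max[OF lt] fin unfolding growth_def by (rule le_less_trans)
    note G = ereal_expectation_elog_finite[OF _ payoff_nonneg[OF lt] neg this]
    have G1: "AE \<omega> in M. 0 < lt \<bullet> V \<omega>" by (rule G(1)) measurable
    have G2: "integrable M (\<lambda>\<omega>. ln (lt \<bullet> V \<omega>))" by (rule G(2)) measurable
    have G3: "growth lt = ereal (\<integral>\<omega>. ln (lt \<bullet> V \<omega>) \<partial>M)" unfolding growth_def by (rule G(3)) measurable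
    have "(\<integral>\<omega>. ln (lt \<bullet> V \<omega>) \<partial>M) \<le> (\<integral>\<omega>. ln (l \<bullet> V \<omega>) \<partial>M)"
      using max[OF lt] unfolding F(3) G3 by simp
    then have le0: "(\<integral>\<omega>. ln (lt \<bullet> V \<omega>) - ln (l \<bullet> V \<omega>) \<partial>M) \<le> 0"
      using F(2) G2 by simp
    let ?d = "\<lambda>\<omega>. (ln (lt \<bullet> V \<omega>) - ln (l \<bullet> V \<omega>)) / t + 2"
    have eq: "AE \<omega> in M. D t \<omega> + 2 = ?d \<omega> \<and> 0 \<le> D t \<omega> + 2"
      using F(1) G1 AE_space
    proof eventually_elim
      fix \<omega> assume *: "0 < l \<bullet> V \<omega>" "0 < lt \<bullet> V \<omega>" "\<omega> \<in> space M"
      have "1 + t * (R \<omega> - 1) = (lt \<bullet> V \<omega>) / (l \<bullet> V \<omega>)"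
        using * by (simp add: R_def ltV field_simps)
      then have "ln (1 + t * (R \<omega> - 1)) = ln (lt \<bullet> V \<omega>) - ln (l \<bullet> V \<omega>)"
        using * by (simp add: ln_div)
      moreover have "0 \<le> D t \<omega> + 2"
      proof -
        have "1 - t \<le> 1 + t * (R \<omega> - 1)" using R_nonneg[OF *(3)] t by (simp add: algebra_simps)
        then have "ln (1 - t) \<le> ln (1 + t * (R \<omega> - 1))" using t by simp
        moreover have "- (2 * t) \<le> ln (1 - t)"
        proof -
          have "ln (1 / (1 - t)) \<le> 1 / (1 - t) - 1" using t by (intro ln_le_minus_one) auto
          also have "\<dots> \<le> 2 * t" using t by (simp add: field_simps)
          finally show ?thesis using t by (simp add: ln_div)
        qed
        ultimately have "- (2 * t) \<le> ln (1 + t * (R \<omega> - 1))" by linarith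
        then show ?thesis using t by (simp add: D_def field_simps)
      qed
      ultimately show "D t \<omega> + 2 = ?d \<omega> \<and> 0 \<le> D t \<omega> + 2" by (simp add: D_def)
    qed
    have "(\<integral>\<^sup>+\<omega>. ennreal (D t \<omega> + 2) \<partial>M) = (\<integral>\<^sup>+\<omega>. ennreal (?d \<omega>) \<partial>M)"
      using eq by (intro nn_integral_cong_AE) auto
    also have "\<dots> = ennreal (\<integral>\<omega>. ?d \<omega> \<partial>M)"
      using eq F(2) G2 by (intro nn_integral_eq_integral) auto
    also have "(\<integral>\<omega>. ?d \<omega> \<partial>M) = (\<integral>\<omega>. ln (lt \<bullet> V \<omega>) - ln (l \<bullet> V \<omega>) \<partial>M) / t + 2"
      using F(2) G2 by (simp add: prob_space)
    also have "ennreal \<dots> \<le> ennreal 2"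
      using le0 t by (intro ennreal_leI) (simp add: field_simps)
    finally show ?thesis by simp
  qed
  have lim: "(\<lambda>k. ennreal (D (1 / real k) \<omega> + 2)) \<longlonglongrightarrow> ennreal (R \<omega> + 1)" for \<omega>
  proof (rule tendsto_ennrealI)
    have "((\<lambda>t. ln (1 + t * (R \<omega> - 1))) has_real_derivative (R \<omega> - 1)) (at 0)"
      by (auto intro!: derivative_eq_intros)
    then have "((\<lambda>t. D t \<omega>) \<longlongrightarrow> R \<omega> - 1) (at 0)"
      by (simp add: has_field_derivative_iff D_def)
    moreover have "filterlim (\<lambda>k. 1 / real k) (at 0) sequentially"
      by (rule filterlim_atI) (auto intro!: lim_1_over_n eventually_sequentiallyI[of 1])
    ultimately have "(\<lambda>k. D (1 / real k) \<omega>) \<longlonglongrightarrow> R \<omega> - 1"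
      by (rule filterlim_compose)
    from tendsto_add[OF this tendsto_const[of 2]] show "(\<lambda>k. D (1 / real k) \<omega> + 2) \<longlonglongrightarrow> R \<omega> + 1" by (simp add: add.commute)
  qed
  have "(\<integral>\<^sup>+\<omega>. ennreal (R \<omega>) \<partial>M) + 1 = (\<integral>\<^sup>+\<omega>. ennreal (R \<omega> + 1) \<partial>M)"
    by (subst nn_integral_cong[where v="\<lambda>\<omega>. ennreal (R \<omega>) + 1"])
       (auto simp: R_nonneg nn_integral_add emeasure_space_1)
  also have "\<dots> = (\<integral>\<^sup>+\<omega>. liminf (\<lambda>k. ennreal (D (1 / real k) \<omega> + 2)) \<partial>M)"
    by (intro nn_integral_cong lim_imp_Liminf[symmetric] lim) simp
  also have "\<dots> \<le> liminf (\<lambda>k. \<integral>\<^sup>+\<omega>. ennreal (D (1 / real k) \<omega> + 2) \<partial>M)"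
    by (rule nn_integral_liminf) measurable
  also have "\<dots> \<le> 2"
  proof -
    have "\<forall>\<^sub>F k in sequentially. (\<integral>\<^sup>+\<omega>. ennreal (D (1 / real k) \<omega> + 2) \<partial>M) \<le> 2"
      by (intro eventually_sequentiallyI[of 2] bound) (auto simp: field_simps)
    then have "liminf (\<lambda>k. \<integral>\<^sup>+\<omega>. ennreal (D (1 / real k) \<omega> + 2) \<partial>M) \<le> liminf (\<lambda>k::nat. 2 :: ennreal)"
      by (rule Liminf_mono)
    then show ?thesis by (simp add: Liminf_const)
  qed
  finally have "(\<integral>\<^sup>+\<omega>. ennreal (R \<omega>) \<partial>M) + 1 \<le> 1 + 1" by simp
  then show ?thesis
    using ennreal_add_left_cancel_le[of 1 "\<integral>\<^sup>+\<omega>. ennreal (R \<omega>) \<partial>M" 1]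
    unfolding R_def by (simp add: add.commute)
qed

end

section \<open>Dominating a density on a product space\<close>

text \<open>
  The measure with density \<open>h\<close> is completed to a probability measure by a point mass at \<open>a\<close>. The sum of
  the two measures is realised as the image of one measure on two copies of the space, one carrying
  the density and the other being collapsed to \<open>a\<close>.
\<close>

lemma complete_to_prob_measure:
  fixes h :: "'a \<Rightarrow> ennreal"
  assumes mu: "prob_space M" and [measurable]: "h \<in> borel_measurable M"
    and le: "(\<integral>\<^sup>+x. h x \<partial>M) \<le> 1" and a: "a \<in> space M"
  obtains N where "prob_space N" "sets N = sets M"
    "\<And>f :: 'a \<Rightarrow> ennreal. f \<in> borel_measurable M \<Longrightarrow>
       (\<integral>\<^sup>+x. f x \<partial>N) = (\<integral>\<^sup>+x. h x * f x \<partial>M) + (1 - (\<integral>\<^sup>+x. h x \<partial>M)) * f a"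
proof -
  interpret M: prob_space M by fact
  let ?r = "1 - (\<integral>\<^sup>+x. h x \<partial>M)"
  define C where "C = count_space (UNIV :: bool set) \<Otimes>\<^sub>M M"
  define g where "g = (\<lambda>z. if fst z then h (snd z) else ?r)"
  define \<phi> where "\<phi> = (\<lambda>z. if fst z then snd z else a)"
  have [measurable]: "g \<in> borel_measurable C" unfolding g_def C_def by measurable
  have [measurable]: "\<phi> \<in> measurable C M" unfolding \<phi>_def C_def using a by measurable
  define N where "N = distr (density C g) M \<phi>"
  have int: "(\<integral>\<^sup>+x. f x \<partial>N) = (\<integral>\<^sup>+x. h x * f x \<partial>M) + ?r * f a"
    if [measurable]: "f \<in> borel_measurable M" for f :: "'a \<Rightarrow> ennreal"
  proof -
    have "(\<integral>\<^sup>+x. f x \<partial>N) = (\<integral>\<^sup>+z. g z * f (\<phi> z) \<partial>C)"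
      unfolding N_def by (simp add: nn_integral_distr nn_integral_density)
    also have "\<dots> = (\<integral>\<^sup>+b. \<integral>\<^sup>+x. g (b, x) * f (\<phi> (b, x)) \<partial>M \<partial>count_space UNIV)"
      unfolding C_def by (rule M.nn_integral_fst[symmetric]) (simp add: C_def[symmetric])
    also have "\<dots> = (\<integral>\<^sup>+x. h x * f x \<partial>M) + ?r * f a"
      by (simp add: nn_integral_count_space_finite UNIV_bool g_def \<phi>_def M.emeasure_space_1)
    finally show ?thesis .
  qed
  have "emeasure N (space N) = (\<integral>\<^sup>+x. 1 \<partial>N)" by simp
  also have "\<dots> = 1" by (subst int) (use le in \<open>auto simp: add_diff_inverse_ennreal\<close>)
  finally have "prob_space N" by (rule prob_spaceI)
  moreover have "sets N = sets M" unfolding N_def by simp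
  ultimately show ?thesis using that int by blast
qed

text \<open>
  If \<open>N\<close> dominates the measure with density \<open>h\<close> in one coordinate, then so do the finite powers, by
  integrating out one coordinate at a time.
\<close>

lemma nn_integral_PiM_density_le:
  fixes h :: "'a \<Rightarrow> ennreal" and w :: "('i \<Rightarrow> 'a) \<Rightarrow> ennreal"
  assumes M: "prob_space M" and N: "prob_space N" and sets: "sets N = sets M"
    and h[measurable]: "h \<in> borel_measurable M"
    and le: "\<And>f :: 'a \<Rightarrow> ennreal. f \<in> borel_measurable M \<Longrightarrow> (\<integral>\<^sup>+x. h x * f x \<partial>M) \<le> (\<integral>\<^sup>+x. f x \<partial>N)"
    and "finite I" and "w \<in> borel_measurable (PiM I (\<lambda>_. M))"
  shows "(\<integral>\<^sup>+x. (\<Prod>i\<in>I. h (x i)) * w x \<partial>PiM I (\<lambda>_. M)) \<le> (\<integral>\<^sup>+x. w x \<partial>PiM I (\<lambda>_. N))"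
  using \<open>finite I\<close> \<open>w \<in> _\<close>
proof (induction I arbitrary: w)
  case empty
  then show ?case by (simp add: PiM_empty nn_integral_count_space_finite)
next
  case (insert i I)
  interpret M: prob_space M by fact
  interpret N: prob_space N by fact
  interpret PI: prob_space "PiM I (\<lambda>_. M)" by (rule prob_space_PiM) (rule M)
  interpret PM: product_sigma_finite "\<lambda>_::'i. M" ..
  interpret PN: product_sigma_finite "\<lambda>_::'i. N" ..
  have [measurable_cong]: "sets N = sets M" by fact
  have w[measurable]: "w \<in> borel_measurable (PiM (insert i I) (\<lambda>_. M))" by fact
  have w': "w \<in> borel_measurable (PiM (insert i I) (\<lambda>_. N))"
    using w by (simp add: measurable_cong_sets[OF sets_PiM_cong[OF refl sets] refl])
  have [simp]: "finite I" "i \<notin> I" by fact+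
  have [measurable]: "(\<lambda>(y, x). w (x(i := y))) \<in> borel_measurable (M \<Otimes>\<^sub>M PiM I (\<lambda>_. M))"
    by measurable
  have sec[measurable]: "(\<lambda>x. w (x(i := y))) \<in> borel_measurable (PiM I (\<lambda>_. M))" if "y \<in> space M" for y
    using that by measurable
  have "(\<integral>\<^sup>+x. (\<Prod>k\<in>insert i I. h (x k)) * w x \<partial>PiM (insert i I) (\<lambda>_. M))
     = (\<integral>\<^sup>+y. \<integral>\<^sup>+x. (\<Prod>k\<in>insert i I. h ((x(i := y)) k)) * w (x(i := y)) \<partial>PiM I (\<lambda>_. M) \<partial>M)"
    by (subst PM.product_nn_integral_insert_rev) auto
  also have "\<dots> = (\<integral>\<^sup>+y. \<integral>\<^sup>+x. h y * ((\<Prod>k\<in>I. h (x k)) * w (x(i := y))) \<partial>PiM I (\<lambda>_. M) \<partial>M)"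
  proof (intro nn_integral_cong)
    fix x y
    have "(\<Prod>k\<in>I. h ((x(i := y)) k)) = (\<Prod>k\<in>I. h (x k))" by (rule prod.cong) auto
    then show "(\<Prod>k\<in>insert i I. h ((x(i := y)) k)) * w (x(i := y)) = h y * ((\<Prod>k\<in>I. h (x k)) * w (x(i := y)))"
      by (simp add: mult.assoc)
  qed
  also have "\<dots> = (\<integral>\<^sup>+y. h y * (\<integral>\<^sup>+x. (\<Prod>k\<in>I. h (x k)) * w (x(i := y)) \<partial>PiM I (\<lambda>_. M)) \<partial>M)"
    by (intro nn_integral_cong nn_integral_cmult borel_measurable_times_ennreal sec) measurable
  also have "\<dots> \<le> (\<integral>\<^sup>+y. \<integral>\<^sup>+x. (\<Prod>k\<in>I. h (x k)) * w (x(i := y)) \<partial>PiM I (\<lambda>_. M) \<partial>N)"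
    by (rule le) measurable
  also have "\<dots> \<le> (\<integral>\<^sup>+y. \<integral>\<^sup>+x. w (x(i := y)) \<partial>PiM I (\<lambda>_. N) \<partial>N)"
    by (intro nn_integral_mono insert.IH sec) (simp add: sets_eq_imp_space_eq[OF sets])
  also have "\<dots> = (\<integral>\<^sup>+x. w x \<partial>PiM (insert i I) (\<lambda>_. N))"
    by (rule PN.product_nn_integral_insert_rev[OF insert.hyps w', symmetric])
  finally show ?case .
qed

lemma nn_integral_PiM_restrict:
  assumes M: "prob_space M" and J: "finite J" "J \<subseteq> I"
    and [measurable]: "f \<in> borel_measurable (PiM J (\<lambda>_. M))"
  shows "(\<integral>\<^sup>+\<omega>. f (restrict \<omega> J) \<partial>PiM I (\<lambda>_. M)) = (\<integral>\<^sup>+x. f x \<partial>PiM J (\<lambda>_. M))"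
proof -
  interpret M: prob_space M by fact
  interpret product_prob_space "\<lambda>_. M" I ..
  have "(\<lambda>\<omega>. restrict \<omega> J) \<in> measurable (PiM I (\<lambda>_. M)) (PiM J (\<lambda>_. M))"
    by (rule measurable_restrict_subset) (rule J)
  then have "(\<integral>\<^sup>+\<omega>. f (restrict \<omega> J) \<partial>PiM I (\<lambda>_. M)) = (\<integral>\<^sup>+x. f x \<partial>distr (PiM I (\<lambda>_. M)) (PiM J (\<lambda>_. M)) (\<lambda>\<omega>. restrict \<omega> J))"
    by (simp add: nn_integral_distr)
  then show ?thesis by (simp add: distr_PiM_restrict_finite[OF J])
qed

section \<open>The observation filtration\<close>

lemma space_obs_space: "space obs_space = {e. (\<forall>j. 0 \<le> e $ j) \<and> e $ None = 1}"
  by (simp add: obs_space_def space_restrict_space)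

lemma measurable_obs_space_borel: "(\<lambda>x. x) \<in> measurable obs_space borel"
  unfolding obs_space_def by (rule measurable_restrict_space1) simp

lemma space_seq_space: "space seq_space = (\<Pi>\<^sub>E n\<in>{1..}. space obs_space)"
  by (simp add: seq_space_def space_PiM)

lemma measurable_E: "1 \<le> n \<Longrightarrow> E n \<in> measurable seq_space obs_space"
  unfolding seq_space_def E_def[abs_def] by measurable

lemma space_Filt: "space (Filt n) = space seq_space"
  unfolding Filt_def by (rule space_measure_of) auto

lemma sets_Filt: "sets (Filt n) = sigma_sets (space seq_space)
     {E i -` A \<inter> space seq_space | i A. i \<in> {1..n} \<and> A \<in> sets obs_space}"
  unfolding Filt_def by (rule sets_measure_of) auto

lemma sets_Filt_subset: "sets (Filt n) \<subseteq> sets seq_space"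
  unfolding sets_Filt
  by (rule sets.sigma_sets_subset) (auto intro: measurable_sets[OF measurable_E])

lemma measurable_Filt_imp_seq_space:
  "X \<in> borel_measurable (Filt n) \<Longrightarrow> X \<in> borel_measurable seq_space"
  using sets_Filt_subset[of n] by (auto simp: measurable_def space_Filt)

lemma sets_Filt_cylinder:
  assumes "A \<in> sets (Filt n)" and eq: "\<And>i. i \<in> {1..n} \<Longrightarrow> \<omega> i = \<omega>' i"
    and \<omega>: "\<omega> \<in> space seq_space" "\<omega>' \<in> space seq_space"
  shows "\<omega> \<in> A \<longleftrightarrow> \<omega>' \<in> A"
  using assms(1) unfolding sets_Filt
  by induction (use eq \<omega> in \<open>auto simp: E_def\<close>)

text \<open>
  The level sets of a function measurable for \<open>Filt n\<close> are events determined by the first \<open>n\<close>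
  observations, and hence so is the function.
\<close>

lemma measurable_Filt_cylinder:
  fixes X :: "(nat \<Rightarrow> real ^ 'd::finite option) \<Rightarrow> real"
  assumes "X \<in> borel_measurable (Filt n)" and eq: "\<And>i. i \<in> {1..n} \<Longrightarrow> \<omega> i = \<omega>' i"
    and \<omega>: "\<omega> \<in> space seq_space" "\<omega>' \<in> space seq_space"
  shows "X \<omega> = X \<omega>'"
proof -
  have "X -` {X \<omega>} \<inter> space (Filt n) \<in> sets (Filt n)"
    using assms(1) by (rule measurable_sets) simp
  from sets_Filt_cylinder[OF this eq \<omega>] show ?thesis using \<omega> by (auto simp: space_Filt)
qed

lemma restrict_E:
  assumes "\<omega> \<in> space seq_space"
  shows "(\<lambda>i\<in>{1..}. E i \<omega>) = \<omega>"
proof -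
  have "\<omega> \<in> extensional {1..}" using assms by (simp add: space_seq_space PiE_iff)
  then show ?thesis unfolding E_def by (rule extensional_restrict)
qed

text \<open>
  The product of the first \<open>n\<close> densities acts as a likelihood ratio on \<open>Filt n\<close>. A variable measurable for
  \<open>Filt n\<close> is unchanged if all later observations are replaced by a fixed one, so it is a measurable
  function of the first \<open>n\<close> observations, and the claim reduces to finite products.
\<close>

lemma nn_integral_seq_space_density_le:
  fixes h :: "real ^ 'd::finite option \<Rightarrow> ennreal" and X :: "(nat \<Rightarrow> real ^ 'd option) \<Rightarrow> real"
  assumes M: "prob_space M" "sets M = sets obs_space" and N: "prob_space N" "sets N = sets obs_space"
    and h[measurable]: "h \<in> borel_measurable obs_space"
    and le: "\<And>f :: real ^ 'd option \<Rightarrow> ennreal. f \<in> borel_measurable obs_space \<Longrightarrow>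
       (\<integral>\<^sup>+x. h x * f x \<partial>M) \<le> (\<integral>\<^sup>+x. f x \<partial>N)"
    and X: "X \<in> borel_measurable (Filt n)"
  shows "(\<integral>\<^sup>+\<omega>. (\<Prod>i\<in>{1..n}. h (\<omega> i)) * ennreal (X \<omega>) \<partial>PiM {1..} (\<lambda>_. M))
    \<le> (\<integral>\<^sup>+\<omega>. ennreal (X \<omega>) \<partial>PiM {1..} (\<lambda>_. N))"
proof -
  let ?I = "{1..n}"
  have [measurable]: "X \<in> borel_measurable seq_space" using X by (rule measurable_Filt_imp_seq_space)
  define a :: "real ^ 'd option" where "a = axis None 1"
  have a: "a \<in> space obs_space" by (auto simp: a_def space_obs_space axis_def)
  define extend where "extend x = (\<lambda>i\<in>{1..}. if i \<in> ?I then x i else a)" for x :: "nat \<Rightarrow> real ^ 'd option"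
  have extend[measurable]: "extend \<in> measurable (PiM ?I (\<lambda>_. obs_space)) seq_space"
    unfolding extend_def[abs_def] seq_space_def
  proof (rule measurable_restrict)
    fix i
    show "(\<lambda>x. if i \<in> ?I then x i else a) \<in> measurable (PiM ?I (\<lambda>_. obs_space)) obs_space"
      using a by (cases "i \<in> ?I") (simp_all del: atLeastAtMost_iff)
  qed
  define w where "w x = ennreal (X (extend x))" for x
  have w: "w \<in> borel_measurable (PiM ?I (\<lambda>_. obs_space))" unfolding w_def by measurable
  have Xw: "ennreal (X \<omega>) = w (restrict \<omega> ?I)" if "\<omega> \<in> space seq_space" for \<omega>
  proof -
    have "restrict \<omega> ?I \<in> space (PiM ?I (\<lambda>_. obs_space))"
      using that by (auto simp: space_seq_space space_PiM)
    then have "extend (restrict \<omega> ?I) \<in> space seq_space" by (rule measurable_space[OF extend])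
    from measurable_Filt_cylinder[OF X _ that this] have "X \<omega> = X (extend (restrict \<omega> ?I))"
      by (simp add: extend_def)
    then show ?thesis by (simp add: w_def)
  qed
  have sets_PiM: "sets (PiM J (\<lambda>_. L)) = sets (PiM J (\<lambda>_. obs_space))"
    if "sets L = sets obs_space" for L and J :: "nat set"
    by (rule sets_PiM_cong[OF refl that])
  have sp: "space (PiM {1..} (\<lambda>_. L)) = space seq_space" if "sets L = sets obs_space" for L
    unfolding seq_space_def by (rule sets_eq_imp_space_eq[OF sets_PiM[OF that]])
  have wm: "w \<in> borel_measurable (PiM ?I (\<lambda>_. L))" if "sets L = sets obs_space" for L
    unfolding measurable_cong_sets[OF sets_PiM[OF that] refl] by (rule w)
  have hM: "h \<in> borel_measurable M" unfolding measurable_cong_sets[OF M(2) refl] by (rule h)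
  have pw: "(\<lambda>x. (\<Prod>i\<in>?I. h (x i)) * w x) \<in> borel_measurable (PiM ?I (\<lambda>_. M))"
    unfolding measurable_cong_sets[OF sets_PiM[OF M(2)] refl]
    by (intro borel_measurable_times_ennreal w borel_measurable_prod_ennreal
        measurable_compose[OF _ h] measurable_component_singleton)
  have "(\<integral>\<^sup>+\<omega>. (\<Prod>i\<in>?I. h (\<omega> i)) * ennreal (X \<omega>) \<partial>PiM {1..} (\<lambda>_. M))
     = (\<integral>\<^sup>+\<omega>. (\<Prod>i\<in>?I. h (restrict \<omega> ?I i)) * w (restrict \<omega> ?I) \<partial>PiM {1..} (\<lambda>_. M))"
    using sp[OF M(2)] by (intro nn_integral_cong) (simp add: Xw)
  also have "\<dots> = (\<integral>\<^sup>+x. (\<Prod>i\<in>?I. h (x i)) * w x \<partial>PiM ?I (\<lambda>_. M))"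
    by (rule nn_integral_PiM_restrict[OF M(1) _ _ pw]) auto
  also have "\<dots> \<le> (\<integral>\<^sup>+x. w x \<partial>PiM ?I (\<lambda>_. N))"
  proof (rule nn_integral_PiM_density_le[OF M(1) N(1) _ hM _ _ wm[OF M(2)]])
    show "sets N = sets M" using M(2) N(2) by simp
    fix f :: "real ^ 'd option \<Rightarrow> ennreal" assume "f \<in> borel_measurable M"
    then show "(\<integral>\<^sup>+x. h x * f x \<partial>M) \<le> (\<integral>\<^sup>+x. f x \<partial>N)"
      unfolding measurable_cong_sets[OF M(2) refl] by (rule le)
  qed simp
  also have "\<dots> = (\<integral>\<^sup>+\<omega>. w (restrict \<omega> ?I) \<partial>PiM {1..} (\<lambda>_. N))"
    by (rule nn_integral_PiM_restrict[OF N(1) _ _ wm[OF N(2)], symmetric]) auto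
  also have "\<dots> = (\<integral>\<^sup>+\<omega>. ennreal (X \<omega>) \<partial>PiM {1..} (\<lambda>_. N))"
    using sp[OF N(2)] by (intro nn_integral_cong) (simp add: Xw)
  finally show ?thesis .
qed

section \<open>Laws of i.i.d. sequences\<close>

text \<open>
  As sequences in \<open>seq_space\<close> are undefined outside \<open>{1..}\<close>, they are recovered exactly from their
  observations, and independence determines the whole law.
\<close>

lemma iid_distribution_imp_PiM:
  assumes "iid_distribution P"
  shows "P = PiM {1..} (\<lambda>_. distr P obs_space (E 1))"
proof -
  interpret prob_space P using assms by (simp add: iid_distribution_def)
  have sets: "sets P = sets seq_space" using assms by (simp add: iid_distribution_def)
  have E: "E i \<in> measurable P obs_space" if "i \<in> {1..}" for i
    using measurable_E[of i] that by (simp add: measurable_cong_sets[OF sets refl])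
  have "P = distr P seq_space (\<lambda>x. x)"
    using sets by (simp add: distr_id2)
  also have "\<dots> = distr P (PiM {1..} (\<lambda>_. obs_space)) (\<lambda>x. \<lambda>i\<in>{1..}. E i x)"
  proof (rule distr_cong)
    fix x assume "x \<in> space P"
    then have "x \<in> space seq_space" using sets_eq_imp_space_eq[OF sets] by simp
    then show "x = (\<lambda>i\<in>{1..}. E i x)" by (rule restrict_E[symmetric])
  qed (simp_all add: seq_space_def)
  also have "\<dots> = PiM {1..} (\<lambda>i. distr P obs_space (E i))"
  proof -
    have "indep_vars (\<lambda>_. obs_space) E {1..}" using assms by (simp add: iid_distribution_def)
    then show ?thesis by (subst (asm) indep_vars_iff_distr_eq_PiM'[OF _ E]) auto
  qed
  also have "\<dots> = PiM {1..} (\<lambda>i. distr P obs_space (E 1))"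
  proof (rule PiM_cong[OF refl])
    fix i :: nat assume "i \<in> {1..}"
    then show "distr P obs_space (E i) = distr P obs_space (E 1)"
      using assms unfolding iid_distribution_def by blast
  qed
  finally show ?thesis .
qed

lemma iid_distribution_PiM:
  assumes N: "prob_space N" and sets: "sets N = sets obs_space"
  shows "iid_distribution (PiM {1..} (\<lambda>_. N))" (is "iid_distribution ?P")
    and "distr (PiM {1..} (\<lambda>_. N)) obs_space (E 1) = N"
proof -
  interpret N: prob_space N by fact
  interpret prob_space ?P by (rule prob_space_PiM) (rule N)
  have sP: "sets ?P = sets seq_space"
    unfolding seq_space_def by (rule sets_PiM_cong) (simp_all add: sets)
  have E: "E i \<in> measurable ?P obs_space" if "i \<in> {1..}" for i
    unfolding measurable_cong_sets[OF sP refl] using that by (intro measurable_E) simp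
  have law: "distr ?P obs_space (E n) = N" if "n \<in> {1..}" for n
  proof -
    have "distr ?P obs_space (E n) = distr ?P N (\<lambda>\<omega>. \<omega> n)"
      by (rule distr_cong) (simp_all add: sets E_def)
    also have "\<dots> = N" using that N by (intro distr_PiM_component) auto
    finally show ?thesis .
  qed
  have "distr ?P (PiM {1..} (\<lambda>_. obs_space)) (\<lambda>x. \<lambda>i\<in>{1..}. E i x) = distr ?P ?P (\<lambda>x. x)"
  proof (rule distr_cong)
    fix x assume "x \<in> space ?P"
    then have "x \<in> space seq_space" unfolding sets_eq_imp_space_eq[OF sP] .
    then show "(\<lambda>i\<in>{1..}. E i x) = x" by (rule restrict_E)
  qed (simp_all add: sP[unfolded seq_space_def, simplified] )
  also have "\<dots> = ?P" by (rule distr_id2) simp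
  also have "\<dots> = PiM {1..} (\<lambda>i. distr ?P obs_space (E i))"
    by (rule PiM_cong[OF refl law[symmetric]])
  finally have "indep_vars (\<lambda>_. obs_space) E {1..}"
    by (subst indep_vars_iff_distr_eq_PiM'[OF _ E]) auto
  then show "iid_distribution ?P"
    using sP law prob_space_axioms by (simp add: iid_distribution_def)
  show "distr ?P obs_space (E 1) = N" by (rule law) simp
qed

text \<open>
  Observations are indexed from \<open>1\<close>, whereas the strong law above is indexed from \<open>0\<close>; the shift is
  carried out on the product measure.
\<close>

lemma iid_distribution_sum_eventually_le:
  fixes g :: "real ^ 'd::finite option \<Rightarrow> real"
  assumes Q: "iid_distribution Q" and [measurable]: "g \<in> borel_measurable obs_space"
    and int: "integrable Q (\<lambda>\<omega>. g (E 1 \<omega>))" and a: "(\<integral>\<omega>. g (E 1 \<omega>) \<partial>Q) < a"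
  shows "AE \<omega> in Q. \<forall>\<^sub>F n in sequentially. (\<Sum>i<n. g (E (Suc i) \<omega>)) \<le> real n * a"
proof -
  interpret prob_space Q using Q by (simp add: iid_distribution_def)
  have sets: "sets Q = sets seq_space" using Q by (simp add: iid_distribution_def)
  have E[measurable]: "E (Suc i) \<in> measurable Q obs_space" for i
    unfolding measurable_cong_sets[OF sets refl] by (rule measurable_E) simp
  have law: "distr Q obs_space (E (Suc i)) = distr Q obs_space (E (Suc 0))" for i
    using Q unfolding iid_distribution_def by (metis One_nat_def Suc_le_mono zero_le)
  define \<mu> where "\<mu> = distr Q obs_space (E 1)"
  have \<mu>: "prob_space \<mu>" unfolding \<mu>_def One_nat_def by (rule prob_space_distr) (rule E)
  have QP: "Q = PiM {1..} (\<lambda>_. \<mu>)" unfolding \<mu>_def by (rule iid_distribution_imp_PiM[OF Q])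
  have "distr Q (PiM UNIV (\<lambda>_. obs_space)) (\<lambda>\<omega>. \<lambda>i\<in>UNIV. E (Suc i) \<omega>)
      = distr (PiM {1..} (\<lambda>_. \<mu>)) (PiM UNIV (\<lambda>_. \<mu>)) (\<lambda>\<omega>. \<lambda>i\<in>UNIV. \<omega> (Suc i))"
    by (rule distr_cong[OF QP]) (auto simp: E_def \<mu>_def intro!: sets_PiM_cong)
  also have "\<dots> = PiM UNIV (\<lambda>_. \<mu>)"
    using \<mu> by (rule distr_PiM_reindex) auto
  also have "\<dots> = PiM UNIV (\<lambda>i. distr Q obs_space (E (Suc i)))"
    unfolding \<mu>_def One_nat_def by (rule PiM_cong[OF refl law[symmetric]])
  finally have "indep_vars (\<lambda>_. obs_space) (\<lambda>i. E (Suc i)) UNIV"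
    by (subst indep_vars_iff_distr_eq_PiM'[OF _ E]) auto
  then have indep: "indep_vars (\<lambda>_. borel) (\<lambda>i \<omega>. g (E (Suc i) \<omega>)) UNIV"
    by (rule indep_vars_compose2) simp
  have ident: "distr Q borel (\<lambda>\<omega>. g (E (Suc i) \<omega>)) = distr Q borel (\<lambda>\<omega>. g (E (Suc 0) \<omega>))" for i
  proof -
    have "distr Q borel (\<lambda>\<omega>. g (E (Suc i) \<omega>)) = distr (distr Q obs_space (E (Suc i))) borel g" for i
      by (subst distr_distr) (auto simp: comp_def)
    then show ?thesis by (simp only: law[of i])
  qed
  show ?thesis
    by (rule iid_sum_eventually_le[OF indep ident]) (use int a in simp_all)
qed

section \<open>Growth of nonnegative processes with bounded expectation\<close>

lemma test_supermartingale_nn_integral_le_1: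
  assumes P: "prob_space P" and sets: "sets P = sets seq_space"
    and M: "test_supermartingale P M" and "1 \<le> n"
  shows "(\<integral>\<^sup>+\<omega>. ennreal (M n \<omega>) \<partial>P) \<le> 1"
  using \<open>1 \<le> n\<close>
proof (induction n rule: nat_induct_at_least)
  case base
  then show ?case using M by (simp add: test_supermartingale_def)
next
  case (Suc n)
  interpret prob_space P by fact
  have sub: "subalgebra P (Filt n)"
    using sets_Filt_subset[of n] sets sets_eq_imp_space_eq[OF sets] by (auto simp: subalgebra_def space_Filt)
  interpret finite_measure_subalgebra P "Filt n" by standard (rule sub)
  have [measurable]: "M k \<in> borel_measurable P" if "1 \<le> k" for k
  proof -
    have "M k \<in> borel_measurable (Filt k)" using M that by (auto simp: test_supermartingale_def nonneg_adapted_def)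
    from measurable_Filt_imp_seq_space[OF this] show ?thesis by (simp add: measurable_cong_sets[OF sets refl])
  qed
  have "(\<integral>\<^sup>+\<omega>. ennreal (M (Suc n) \<omega>) \<partial>P) = (\<integral>\<^sup>+\<omega>. nn_cond_exp P (Filt n) (\<lambda>\<omega>. ennreal (M (Suc n) \<omega>)) \<omega> \<partial>P)"
    using nn_cond_exp_intg[of "\<lambda>_. 1" "\<lambda>\<omega>. ennreal (M (Suc n) \<omega>)"] by simp
  also have "\<dots> \<le> (\<integral>\<^sup>+\<omega>. ennreal (M n \<omega>) \<partial>P)"
  proof (rule nn_integral_mono_AE)
    have "AE \<omega> in P. nn_cond_exp P (Filt (Suc n - 1)) (\<lambda>\<omega>. ennreal (M (Suc n) \<omega>)) \<omega> \<le> ennreal (M (Suc n - 1) \<omega>)"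
      by (rule M[unfolded test_supermartingale_def, THEN conjunct2, THEN conjunct1, rule_format]) (use Suc.hyps in simp)
    then show "AE \<omega> in P. nn_cond_exp P (Filt n) (\<lambda>\<omega>. ennreal (M (Suc n) \<omega>)) \<omega> \<le> ennreal (M n \<omega>)"
      by simp
  qed
  also have "\<dots> \<le> 1" by (rule Suc.IH)
  finally show ?case .
qed

lemma e_process_nn_integral_le_1:
  assumes W: "e_process \<P> W" and P: "P \<in> \<P>" "prob_space P" "sets P = sets seq_space" and n: "1 \<le> n"
  shows "(\<integral>\<^sup>+\<omega>. ennreal (W n \<omega>) \<partial>P) \<le> 1"
proof -
  obtain M where M: "test_supermartingale P M" and le: "AE \<omega> in P. \<forall>n\<ge>1. W n \<omega> \<le> M n \<omega>"
    using W P(1) by (auto simp: e_process_def)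
  have "(\<integral>\<^sup>+\<omega>. ennreal (W n \<omega>) \<partial>P) \<le> (\<integral>\<^sup>+\<omega>. ennreal (M n \<omega>) \<partial>P)"
    using le by (intro nn_integral_mono_AE, eventually_elim) (use n in \<open>auto intro: ennreal_leI\<close>)
  also have "\<dots> \<le> 1" by (rule test_supermartingale_nn_integral_le_1[OF P(2,3) M n])
  finally show ?thesis .
qed

text \<open>
  By Markov's inequality the probability of exceeding \<open>exp (\<epsilon> * n)\<close> is at most \<open>exp (- \<epsilon> * n)\<close>, which is
  summable, so the Borel--Cantelli lemma applies.
\<close>

lemma (in prob_space) eventually_le_exp_of_nn_integral_le_1:
  fixes X :: "nat \<Rightarrow> 'a \<Rightarrow> ennreal"
  assumes [measurable]: "\<And>n. X n \<in> borel_measurable M"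
    and le: "\<And>n. (\<integral>\<^sup>+\<omega>. X n \<omega> \<partial>M) \<le> 1" and \<epsilon>: "0 < \<epsilon>"
  shows "AE \<omega> in M. \<forall>\<^sub>F n in sequentially. X n \<omega> \<le> ennreal (exp (\<epsilon> * real n))"
proof -
  define A where "A n = {\<omega>\<in>space M. 1 \<le> ennreal (exp (- \<epsilon> * real n)) * X n \<omega>}" for n
  have [measurable]: "A n \<in> sets M" for n unfolding A_def by measurable
  have prob: "measure M (A n) \<le> exp (- \<epsilon>) ^ n" for n
  proof -
    have "emeasure M (A n) = emeasure M ({\<omega>\<in>space M. 1 \<le> ennreal (exp (- \<epsilon> * real n)) * X n \<omega>} \<inter> space M)"
      by (auto simp: A_def intro!: arg_cong2[where f=emeasure])
    also have "\<dots> \<le> ennreal (exp (- \<epsilon> * real n)) * (\<integral>\<^sup>+\<omega>. X n \<omega> * indicator (space M) \<omega> \<partial>M)"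
      using nn_integral_Markov_inequality[of "X n" "space M" M "ennreal (exp (- \<epsilon> * real n))"]
      by (simp add: Int_def conj_commute cong: conj_cong)
    also have "(\<integral>\<^sup>+\<omega>. X n \<omega> * indicator (space M) \<omega> \<partial>M) = (\<integral>\<^sup>+\<omega>. X n \<omega> \<partial>M)"
      by (rule nn_integral_cong) simp
    also have "ennreal (exp (- \<epsilon> * real n)) * \<dots> \<le> ennreal (exp (- \<epsilon> * real n)) * 1"
      by (intro mult_left_mono le) simp
    finally show ?thesis
      by (simp add: emeasure_eq_measure exp_of_nat_mult[symmetric] mult.commute)
  qed
  have "summable (\<lambda>n. measure M (A n))"
    by (rule summable_comparison_test'[of "\<lambda>n. exp (- \<epsilon>) ^ n" 0]) (use prob \<epsilon> in \<open>auto intro!: summable_geometric\<close>)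
  then have "AE \<omega> in M. \<forall>\<^sub>F n in sequentially. \<omega> \<in> space M - A n"
    by (intro borel_cantelli_AE1) (auto simp: less_top[symmetric])
  then show ?thesis
  proof eventually_elim
    fix \<omega> assume "\<forall>\<^sub>F n in sequentially. \<omega> \<in> space M - A n"
    then show "\<forall>\<^sub>F n in sequentially. X n \<omega> \<le> ennreal (exp (\<epsilon> * real n))"
    proof eventually_elim
      fix n assume "\<omega> \<in> space M - A n"
      then have "ennreal (exp (- \<epsilon> * real n)) * X n \<omega> \<le> 1" by (auto simp: A_def)
      then have "ennreal (exp (\<epsilon> * real n)) * (ennreal (exp (- \<epsilon> * real n)) * X n \<omega>) \<le> ennreal (exp (\<epsilon> * real n)) * 1"
        by (rule mult_left_mono) simp
      also have "ennreal (exp (\<epsilon> * real n)) * (ennreal (exp (- \<epsilon> * real n)) * X n \<omega>) = X n \<omega>"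
        by (simp add: mult.assoc[symmetric] ennreal_mult[symmetric] exp_add[symmetric])
      finally show "X n \<omega> \<le> ennreal (exp (\<epsilon> * real n))" by simp
    qed
  qed
qed

section \<open>The growth rate of an e-process\<close>

theorem proposition2p2:
  fixes Q :: "(nat \<Rightarrow> real ^ 'd::finite option) measure"
    and W :: "nat \<Rightarrow> (nat \<Rightarrow> real ^ 'd option) \<Rightarrow> real"
  assumes "e_process null_hypothesis W"
    and "iid_distribution Q"
    and "\<And>l. l \<in> prob_simplex \<Longrightarrow> ereal_expectation_defined Q (\<lambda>\<omega>. elog (l \<bullet> E 1 \<omega>))"
  shows "(\<exists>l\<in>prob_simplex. growth_rate Q l = ell_star Q) \<and>
         (AE \<omega> in Q. limsup (\<lambda>n. ereal (1 / real n) * elog (W n \<omega>)) \<le> ell_star Q)"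
proof -
  note W = assms(1) and Q = assms(2)
  interpret Q: prob_space Q using Q by (simp add: iid_distribution_def)
  have setsQ: "sets Q = sets seq_space" using Q by (simp add: iid_distribution_def)
  have E[measurable]: "E n \<in> measurable Q obs_space" if "1 \<le> n" for n
    unfolding measurable_cong_sets[OF setsQ refl] by (rule measurable_E) fact
  have E1[measurable]: "E 1 \<in> measurable Q obs_space" by (rule E) simp
  have obs: "E n \<omega> \<in> space obs_space" if "1 \<le> n" "\<omega> \<in> space Q" for n \<omega>
    using measurable_space[OF E[OF that(1)] that(2)] .
  interpret payoff_vector Q "E 1"
  proof
    show "E 1 \<in> borel_measurable Q"
      using measurable_compose[OF E1 measurable_obs_space_borel] by simp
  qed (use obs[of 1] in \<open>auto simp: space_obs_space\<close>)
  have growth: "growth = growth_rate Q"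
    unfolding fun_eq_iff growth_def growth_rate_def by (intro allI refl)
  obtain l where l: "l \<in> prob_simplex" and max: "\<And>l'. l' \<in> prob_simplex \<Longrightarrow> growth l' \<le> growth l"
    using growth_attains_max by blast
  have star: "ell_star Q = growth l"
    unfolding ell_star_def growth[symmetric]
    by (intro antisym SUP_least SUP_upper max l)
  have "AE \<omega> in Q. limsup (\<lambda>n. ereal (1 / real n) * elog (W n \<omega>)) \<le> growth l"
  proof (cases "growth l = \<infinity>")
    case False
    then have fin: "growth l < \<infinity>" by simp
    have "0 \<le> growth l" using max[OF axis_in_prob_simplex[of None]] unfolding growth_bank .
    note F = growth_finite[OF l this fin]
    define L where "L = (\<integral>\<omega>. ln (l \<bullet> E 1 \<omega>) \<partial>Q)"
    define \<mu> where "\<mu> = distr Q obs_space (E 1)"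
    have \<mu>: "prob_space \<mu>" unfolding \<mu>_def by (rule Q.prob_space_distr) (rule E1)
    have sets\<mu>: "sets \<mu> = sets obs_space" by (simp add: \<mu>_def)
    have QP: "Q = PiM {1..} (\<lambda>_. \<mu>)" unfolding \<mu>_def by (rule iid_distribution_imp_PiM[OF Q])
    have [measurable]: "(\<lambda>e. l \<bullet> e) \<in> borel_measurable obs_space"
      by (rule measurable_compose[OF measurable_obs_space_borel]) simp
    have nth[measurable]: "(\<lambda>e. e $ j) \<in> borel_measurable obs_space" for j :: "'d option"
      by (rule measurable_compose[OF measurable_obs_space_borel]) simp
    \<comment> \<open>The density with respect to \<open>\<mu>\<close> of the null distribution away from the point mass; it is \<open>0\<close> where \<open>l \<bullet> e = 0\<close>, a null set.\<close>
    define h where "h e = ennreal (1 / (l \<bullet> e))" for e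
    have h[measurable]: "h \<in> borel_measurable obs_space" unfolding h_def by measurable
    have numeraire: "(\<integral>\<^sup>+e. h e * ennreal (e $ j) \<partial>\<mu>) \<le> 1" for j
    proof -
      have "(\<integral>\<^sup>+e. h e * ennreal (e $ j) \<partial>\<mu>) = (\<integral>\<^sup>+\<omega>. h (E 1 \<omega>) * ennreal (E 1 \<omega> $ j) \<partial>Q)"
        unfolding \<mu>_def by (subst nn_integral_distr) auto
      also have "\<dots> = (\<integral>\<^sup>+\<omega>. ennreal (E 1 \<omega> $ j / (l \<bullet> E 1 \<omega>)) \<partial>Q)"
      proof (rule nn_integral_cong)
        fix \<omega> assume "\<omega> \<in> space Q"
        then have "0 \<le> E 1 \<omega> $ j" by (rule V_nonneg)
        then show "h (E 1 \<omega>) * ennreal (E 1 \<omega> $ j) = ennreal (E 1 \<omega> $ j / (l \<bullet> E 1 \<omega>))"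
          by (simp add: h_def ennreal_mult''[symmetric])
      qed
      also have "\<dots> \<le> 1" by (rule growth_maximiser_numeraire[OF l max fin])
      finally show ?thesis .
    qed
    \<comment> \<open>Coordinate \<open>0\<close> is constantly \<open>1\<close>, so its bound controls the total mass.\<close>
    have "(\<integral>\<^sup>+e. h e \<partial>\<mu>) = (\<integral>\<^sup>+e. h e * ennreal (e $ None) \<partial>\<mu>)"
      using sets_eq_imp_space_eq[OF sets\<mu>] by (intro nn_integral_cong) (simp add: space_obs_space)
    then have mass: "(\<integral>\<^sup>+e. h e \<partial>\<mu>) \<le> 1" using numeraire[of None] by simp
    have a: "axis None 1 \<in> space \<mu>"
      using sets_eq_imp_space_eq[OF sets\<mu>] by (auto simp: space_obs_space axis_def)
    have meas\<mu>: "f \<in> borel_measurable \<mu> \<longleftrightarrow> f \<in> borel_measurable obs_space" for f :: "_ \<Rightarrow> ennreal"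
      by (simp add: measurable_cong_sets[OF sets\<mu> refl])
    obtain N where N: "prob_space N" "sets N = sets \<mu>"
      and intN: "\<And>f :: _ \<Rightarrow> ennreal. f \<in> borel_measurable \<mu> \<Longrightarrow>
        (\<integral>\<^sup>+x. f x \<partial>N) = (\<integral>\<^sup>+x. h x * f x \<partial>\<mu>) + (1 - (\<integral>\<^sup>+x. h x \<partial>\<mu>)) * f (axis None 1)"
      using complete_to_prob_measure[OF \<mu> h[folded meas\<mu>] mass a] by metis
    have setsN: "sets N = sets obs_space" using N(2) sets\<mu> by simp
    define P where "P = PiM {1..} (\<lambda>_::nat. N)"
    have P: "iid_distribution P" "distr P obs_space (E 1) = N"
      unfolding P_def by (rule iid_distribution_PiM[OF N(1) setsN])+
    have setsP: "prob_space P" "sets P = sets seq_space"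
      using P(1) by (simp_all add: iid_distribution_def)
    have E1P: "E 1 \<in> measurable P obs_space"
      unfolding measurable_cong_sets[OF setsP(2) refl] by (rule measurable_E) simp
    have "(\<integral>\<^sup>+\<omega>. ennreal (E 1 \<omega> $ Some j) \<partial>P) \<le> 1" for j
    proof -
      have "(\<integral>\<^sup>+\<omega>. ennreal (E 1 \<omega> $ Some j) \<partial>P) = (\<integral>\<^sup>+e. ennreal (e $ Some j) \<partial>distr P obs_space (E 1))"
        by (rule nn_integral_distr[OF E1P, symmetric]) simp
      also have "\<dots> = (\<integral>\<^sup>+e. h e * ennreal (e $ Some j) \<partial>\<mu>)"
        unfolding P(2) by (subst intN) (simp_all add: meas\<mu> axis_def)
      also have "\<dots> \<le> 1" by (rule numeraire)
      finally show ?thesis .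
    qed
    then have null: "P \<in> null_hypothesis" using P(1) by (simp add: null_hypothesis_def)
    \<comment> \<open>The e-process divided by the wealth of the optimal portfolio \<open>l\<close>.\<close>
    define X where "X n \<omega> = (\<Prod>i\<in>{1..n}. h (E i \<omega>)) * ennreal (W n \<omega>)" for n \<omega>
    have WF: "W n \<in> borel_measurable (Filt n)" if "1 \<le> n" for n
      using W that by (auto simp: e_process_def nonneg_adapted_def)
    have WQ: "W n \<in> borel_measurable Q" if "1 \<le> n" for n
      unfolding measurable_cong_sets[OF setsQ refl] by (rule measurable_Filt_imp_seq_space[OF WF[OF that]])
    have X_meas: "X n \<in> borel_measurable Q" if "1 \<le> n" for n
    proof -
      have "(\<lambda>\<omega>. h (E i \<omega>)) \<in> borel_measurable Q" if "i \<in> {1..n}" for i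
        using that by (intro measurable_compose[OF E h]) simp
      then have "(\<lambda>\<omega>. \<Prod>i\<in>{1..n}. h (E i \<omega>)) \<in> borel_measurable Q"
        by (rule borel_measurable_prod_ennreal)
      then show ?thesis unfolding X_def using WQ[OF that] by measurable
    qed
    have X_le: "(\<integral>\<^sup>+\<omega>. X n \<omega> \<partial>Q) \<le> 1" if n: "1 \<le> n" for n
    proof -
      have "(\<integral>\<^sup>+\<omega>. X n \<omega> \<partial>Q) = (\<integral>\<^sup>+\<omega>. (\<Prod>i\<in>{1..n}. h (\<omega> i)) * ennreal (W n \<omega>) \<partial>PiM {1..} (\<lambda>_. \<mu>))"
        by (subst QP) (simp add: X_def[abs_def] E_def)
      also have "\<dots> \<le> (\<integral>\<^sup>+\<omega>. ennreal (W n \<omega>) \<partial>P)"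
        unfolding P_def
      proof (rule nn_integral_seq_space_density_le[OF \<mu> sets\<mu> N(1) setsN h _ WF[OF n]])
        fix f :: "real ^ 'd option \<Rightarrow> ennreal" assume "f \<in> borel_measurable obs_space"
        then show "(\<integral>\<^sup>+x. h x * f x \<partial>\<mu>) \<le> (\<integral>\<^sup>+x. f x \<partial>N)" by (subst intN) (simp_all add: meas\<mu>)
      qed
      also have "\<dots> \<le> 1" by (rule e_process_nn_integral_le_1[OF W null setsP n])
      finally show ?thesis .
    qed
    have pos: "AE \<omega> in Q. \<forall>i\<in>{1..}. 0 < l \<bullet> E i \<omega>"
    proof (rule AE_ball_countable')
      fix i :: nat assume i: "i \<in> {1..}"
      have "AE e in \<mu>. 0 < l \<bullet> e"
        unfolding \<mu>_def using F(1) by (subst AE_distr_iff) auto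
      then show "AE \<omega> in Q. 0 < l \<bullet> E i \<omega>"
        unfolding E_def using i \<mu> by (subst QP, intro AE_PiM_component) auto
    qed simp
    have bound: "AE \<omega> in Q. limsup (\<lambda>n. ereal (1 / real n) * elog (W n \<omega>)) \<le> ereal (L + 2 * \<epsilon>)"
      if \<epsilon>: "0 < \<epsilon>" for \<epsilon>
    proof -
      \<comment> \<open>\<open>W 0\<close> is unconstrained, so the expectations are only bounded from \<open>n = 1\<close> on.\<close>
      have "AE \<omega> in Q. \<forall>\<^sub>F n in sequentially. X (Suc n) \<omega> \<le> ennreal (exp (\<epsilon> * real n))"
        by (rule Q.eventually_le_exp_of_nn_integral_le_1[OF _ _ \<epsilon>]) (auto intro!: X_meas X_le)
      moreover have "AE \<omega> in Q. \<forall>\<^sub>F n in sequentially. (\<Sum>i<n. ln (l \<bullet> E (Suc i) \<omega>)) \<le> real n * (L + \<epsilon>)"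
        using \<epsilon> by (intro iid_distribution_sum_eventually_le[OF Q _ F(2)]) (auto simp: L_def)
      ultimately show ?thesis using pos AE_space
      proof eventually_elim
        fix \<omega>
        assume "\<forall>\<^sub>F n in sequentially. X (Suc n) \<omega> \<le> ennreal (exp (\<epsilon> * real n))"
          and S: "\<forall>\<^sub>F n in sequentially. (\<Sum>i<n. ln (l \<bullet> E (Suc i) \<omega>)) \<le> real n * (L + \<epsilon>)"
          and pos: "\<forall>i\<in>{1..}. 0 < l \<bullet> E i \<omega>" and \<omega>: "\<omega> \<in> space Q"
        then have "\<forall>\<^sub>F n in sequentially. X (Suc n) \<omega> \<le> ennreal (exp (\<epsilon> * real (Suc n)))"
          using \<epsilon> by (auto elim!: eventually_mono intro!: ennreal_leI intro: order_trans)
        then have X: "\<forall>\<^sub>F n in sequentially. X n \<omega> \<le> ennreal (exp (\<epsilon> * real n))"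
          by (subst (asm) eventually_sequentially_Suc)
        have "\<forall>\<^sub>F n in sequentially. ereal (1 / real n) * elog (W n \<omega>) \<le> ereal (L + 2 * \<epsilon>)"
          using X S eventually_ge_at_top[of 1]
        proof eventually_elim
          fix n :: nat
          assume X: "X n \<omega> \<le> ennreal (exp (\<epsilon> * real n))"
            and S: "(\<Sum>i<n. ln (l \<bullet> E (Suc i) \<omega>)) \<le> real n * (L + \<epsilon>)" and n: "1 \<le> n"
          let ?S = "\<Sum>i<n. ln (l \<bullet> E (Suc i) \<omega>)"
          have W0: "0 \<le> W n \<omega>"
            using W n \<omega> sets_eq_imp_space_eq[OF setsQ] by (auto simp: e_process_def nonneg_adapted_def)
          have "(\<Prod>i\<in>{1..n}. h (E i \<omega>)) = (\<Prod>i<n. h (E (Suc i) \<omega>))"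
            by (rule prod.reindex_bij_witness[of _ Suc "\<lambda>i. i - 1"]) auto
          also have "\<dots> = (\<Prod>i<n. ennreal (exp (- ln (l \<bullet> E (Suc i) \<omega>))))"
            using pos by (intro prod.cong refl) (simp add: h_def exp_minus divide_inverse)
          also have "\<dots> = ennreal (exp (- ?S))"
            by (simp add: prod_ennreal exp_sum[symmetric] sum_negf)
          finally have "ennreal (exp (- ?S) * W n \<omega>) \<le> ennreal (exp (\<epsilon> * real n))"
            using X by (simp add: X_def ennreal_mult')
          then have "exp (- ?S) * W n \<omega> \<le> exp (\<epsilon> * real n)" by simp
          then have "exp ?S * (exp (- ?S) * W n \<omega>) \<le> exp ?S * exp (\<epsilon> * real n)" by simp
          then have Wle: "W n \<omega> \<le> exp (?S + \<epsilon> * real n)"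
            by (simp add: mult.assoc[symmetric] exp_add[symmetric])
          show "ereal (1 / real n) * elog (W n \<omega>) \<le> ereal (L + 2 * \<epsilon>)"
          proof (cases "W n \<omega> = 0")
            case False
            then have "ln (W n \<omega>) \<le> ln (exp (?S + \<epsilon> * real n))"
              using Wle W0 by (subst ln_le_cancel_iff) auto
            also have "\<dots> = ?S + \<epsilon> * real n" by (rule ln_exp)
            also have "\<dots> \<le> real n * (L + 2 * \<epsilon>)" using S by (simp add: algebra_simps)
            finally have "ln (W n \<omega>) / real n \<le> L + 2 * \<epsilon>" using n by (simp add: field_simps)
            then show ?thesis using False by (simp add: elog_def)
          qed (use n in \<open>simp add: elog_def\<close>)
        qed
        then show "limsup (\<lambda>n. ereal (1 / real n) * elog (W n \<omega>)) \<le> ereal (L + 2 * \<epsilon>)"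
          by (rule Limsup_bounded)
      qed
    qed
    have "AE \<omega> in Q. \<forall>k. limsup (\<lambda>n. ereal (1 / real n) * elog (W n \<omega>)) \<le> ereal (L + 2 * (1 / real (Suc k)))"
      unfolding AE_all_countable by (intro allI bound) simp
    then show ?thesis
    proof eventually_elim
      fix \<omega>
      assume *: "\<forall>k. limsup (\<lambda>n. ereal (1 / real n) * elog (W n \<omega>)) \<le> ereal (L + 2 * (1 / real (Suc k)))"
      have "(\<lambda>k. L + 2 * (1 / real (Suc k))) \<longlonglongrightarrow> L + 2 * 0"
        by (intro tendsto_intros LIMSEQ_Suc lim_1_over_n)
      then have "(\<lambda>k. ereal (L + 2 * (1 / real (Suc k)))) \<longlonglongrightarrow> ereal L"
        by (intro tendsto_ereal) simp
      then have "limsup (\<lambda>n. ereal (1 / real n) * elog (W n \<omega>)) \<le> ereal L"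
        by (rule LIMSEQ_le_const) (use * in blast)
      then show "limsup (\<lambda>n. ereal (1 / real n) * elog (W n \<omega>)) \<le> growth l"
        unfolding F(3) L_def .
    qed
  qed simp
  then show ?thesis
    using l unfolding star growth by blast
qed

end
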